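(* Let $(V,\circ,e)$ be a finite-dimensional Euclidean Jordan algebra over $\mathbb{R}$ with identity element $e$ and rank $r$, let $\Omega$ be the interior of its cone of squares, and let $L\subseteq V$ be a linear subspace. If $L\cap\Omega\neq\emptyset$, then the Projection and Rescaling Algorithm for symmetric conic systems (described in the context) finds a point $x\in L\cap\Omega$ in at most $\log_{1.5}\bigl(1/\delta(L\cap\Omega)\bigr)$ main iterations.
   Context: Euclidean Jordan algebra: $\circ:V\times V\to V$ is bilinear and commutative, $x\circ(x^2\circ y)=x^2\circ(x\circ y)$ with $x^2=x\circ x$, $x\circ e=x$, and there is an associative positive definite bilinear form on $V$. The rank $r$ is the smallest integer such that $\{e,x,\dots,x^r\}$ is linearly dependent for all $x\in V$. Every $x\in V$ has a spectral decomposition $x=\sum_{i=1}^r\lambda_i(x)c_i$, where $\{c_1,\dots,c_r\}$ is a Jordan frame (non-zero primitive idempotents, $c_i\circ c_j=0$ for $i\ne j$, $\sum_i c_i=e$); an idempotent is primitive if it is not the sum of two other (non-zero) idempotents. Put $\mathrm{trace}(x)=\sum_i\lambda_i(x)$, $\det(x)=\prod_i\lambda_i(x)$. $V$ carries the inner product $\langle x,y\rangle=\mathrm{trace}(x\circ y)$; $\|x\|_F=\sqrt{\langle x,x\rangle}=\|\lambda(x)\|_2$, $\|x\|=\|\lambda(x)\|_\infty$, $\lambda_{\max}(x)=\max_i\lambda_i(x)$. $\Omega=\mathrm{int}\{x^2:x\in V\}$, $\bar\Omega$ is its closure, and $v^+$ denotes the orthogonal projection of $v\in V$ onto $\bar\Omega$,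 i.e. $v^+=\sum_i\max\{\lambda_i(v),0\}c_i$. For a subspace $M\subseteq V$, $P_M$ is the orthogonal projection onto $M$. Condition measure, for a subspace $M$ with $M\cap\Omega\ne\emptyset$: $\delta(M\cap\Omega)=\max\{\det(x):x\in M\cap\Omega,\ \|x\|_F^2=r\}\in(0,1]$. Quadratic mapping associated to $v\in V$: $D_vx=2v\circ(v\circ x)-v^2\circ x$. Algorithm. (1) Initialize $D$ as the identity map on $V$, $P=P_L$, $a=\sqrt2-1$. (2) Basic procedure: find any $z\in\bar\Omega\setminus\{0\}$ such that either $Pz\in\Omega$ or $\|(Pz)^+\|_F\le\frac1{4r}\|z\|$. (3) If $Pz\in\Omega$, halt and return $x=D^{-1}Pz$. (4) Rescaling step: otherwise pick a primitive idempotent $c$ with $z\circ c=\lambda_{\max}(z)c$, let $v=e+ac$, replace $D$ by $D_vD$ and $P$ by $P_{D(L)}$, and go back to (2). A main iteration is one round consisting of a basic procedure followed by a rescaling step; the basic procedure is treated as a black box that returns some $z$ with the required property. The final execution of the basic procedure, in which the algorithm halts and no rescaling takes place, is not counted. *)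

theory Defs
  imports "HOL-Analysis.Analysis"
begin

(* The class euclidean_space supplies finite dimension and the canonical topology of the
   vector space. Its inner product is otherwise unrelated to the Jordan structure; all lengths
   and projections below refer to the trace form. *)
class euclidean_jordan_algebra = euclidean_space +
  fixes jprod :: "'a \<Rightarrow> 'a \<Rightarrow> 'a"  (infixl "\<circ>\<^sub>J" 70)
    and junit :: 'a
  assumes jprod_add_left: "(x + y) \<circ>\<^sub>J z = x \<circ>\<^sub>J z + y \<circ>\<^sub>J z"
    and jprod_scaleR_left: "(s *\<^sub>R x) \<circ>\<^sub>J y = s *\<^sub>R (x \<circ>\<^sub>J y)"
    and jprod_commute: "x \<circ>\<^sub>J y = y \<circ>\<^sub>J x"
    and jordan_identity: "x \<circ>\<^sub>J ((x \<circ>\<^sub>J x) \<circ>\<^sub>J y) = (x \<circ>\<^sub>J x) \<circ>\<^sub>J (x \<circ>\<^sub>J y)"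
    and jprod_unit: "x \<circ>\<^sub>J junit = x"
    and associative_form: "\<exists>B :: 'a \<Rightarrow> 'a \<Rightarrow> real.
      (\<forall>x y z. B (x + y) z = B x z + B y z \<and> B x (y + z) = B x y + B x z) \<and>
      (\<forall>s x y. B (s *\<^sub>R x) y = s * B x y \<and> B x (s *\<^sub>R y) = s * B x y) \<and>
      (\<forall>x y z. B (x \<circ>\<^sub>J y) z = B x (y \<circ>\<^sub>J z)) \<and> (\<forall>x. x \<noteq> 0 \<longrightarrow> B x x > 0)"

lemma bilinear_jprod:
  "bilinear ((\<circ>\<^sub>J) :: 'a \<Rightarrow> 'a \<Rightarrow> 'a::euclidean_jordan_algebra)"
proof -
  have 1: "linear (\<lambda>x. x \<circ>\<^sub>J y)" for y :: 'a
    by (rule linearI) (rule jprod_add_left, rule jprod_scaleR_left)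
  have 2: "linear (\<lambda>y. x \<circ>\<^sub>J y)" for x :: 'a
    using 1[of x] by (subst jprod_commute)
  show ?thesis
    unfolding bilinear_def using 1 2 by blast
qed

primrec jpow :: "'a::euclidean_jordan_algebra \<Rightarrow> nat \<Rightarrow> 'a" where
  "jpow x 0 = junit"
| "jpow x (Suc k) = x \<circ>\<^sub>J jpow x k"

(* Dependence is that of the family of powers x^0, ..., x^r, so that repeated powers count. *)
definition jrank :: "'a::euclidean_jordan_algebra itself \<Rightarrow> nat" where
  "jrank _ = (LEAST r. \<forall>x::'a. \<exists>u::nat \<Rightarrow> real.
     (\<exists>i\<le>r. u i \<noteq> 0) \<and> (\<Sum>i\<le>r. u i *\<^sub>R jpow x i) = 0)"

definition idempotent :: "'a::euclidean_jordan_algebra \<Rightarrow> bool" where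
  "idempotent c \<longleftrightarrow> c \<circ>\<^sub>J c = c"

definition primitive_idempotent :: "'a::euclidean_jordan_algebra \<Rightarrow> bool" where
  "primitive_idempotent c \<longleftrightarrow> idempotent c \<and> c \<noteq> 0 \<and>
     \<not> (\<exists>p q. idempotent p \<and> p \<noteq> 0 \<and> idempotent q \<and> q \<noteq> 0 \<and> c = p + q)"

definition jordan_frame :: "(nat \<Rightarrow> 'a::euclidean_jordan_algebra) \<Rightarrow> bool" where
  "jordan_frame c \<longleftrightarrow> (\<forall>i<jrank TYPE('a). primitive_idempotent (c i)) \<and>
     (\<forall>i<jrank TYPE('a). \<forall>j<jrank TYPE('a). i \<noteq> j \<longrightarrow> c i \<circ>\<^sub>J c j = 0) \<and>
     (\<Sum>i<jrank TYPE('a). c i) = junit"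

definition spectral_decomposition ::
  "'a::euclidean_jordan_algebra \<Rightarrow> (nat \<Rightarrow> real) \<Rightarrow> (nat \<Rightarrow> 'a) \<Rightarrow> bool" where
  "spectral_decomposition x l c \<longleftrightarrow>
     jordan_frame c \<and> x = (\<Sum>i<jrank TYPE('a). l i *\<^sub>R c i)"

(* The eigenvalues of x, indexed by i < r, in an unspecified order; they are only used
   through functions that do not depend on the order. *)
definition eigval :: "'a::euclidean_jordan_algebra \<Rightarrow> nat \<Rightarrow> real" where
  "eigval x = (SOME l. \<exists>c. spectral_decomposition x l c)"

definition jtrace :: "'a::euclidean_jordan_algebra \<Rightarrow> real" where
  "jtrace x = (\<Sum>i<jrank TYPE('a). eigval x i)"

definition jdet :: "'a::euclidean_jordan_algebra \<Rightarrow> real" where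
  "jdet x = (\<Prod>i<jrank TYPE('a). eigval x i)"

definition eigmax :: "'a::euclidean_jordan_algebra \<Rightarrow> real" where
  "eigmax x = Max (eigval x ` {..<jrank TYPE('a)})"

definition trace_inner :: "'a::euclidean_jordan_algebra \<Rightarrow> 'a \<Rightarrow> real" where
  "trace_inner x y = jtrace (x \<circ>\<^sub>J y)"

definition frob_norm :: "'a::euclidean_jordan_algebra \<Rightarrow> real" where
  "frob_norm x = sqrt (trace_inner x x)"

definition spec_norm :: "'a::euclidean_jordan_algebra \<Rightarrow> real" where
  "spec_norm x = Max ((\<lambda>i. \<bar>eigval x i\<bar>) ` {..<jrank TYPE('a)})"

definition sym_cone :: "'a::euclidean_jordan_algebra set" where
  "sym_cone = interior (range (\<lambda>x. x \<circ>\<^sub>J x))"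

(* The library's closest_point would measure distance in the inner product of the type class. *)
definition cone_proj :: "'a::euclidean_jordan_algebra \<Rightarrow> 'a" where
  "cone_proj v = (THE p. p \<in> closure sym_cone \<and>
     (\<forall>q\<in>closure sym_cone. frob_norm (v - p) \<le> frob_norm (v - q)))"

definition subspace_proj :: "'a::euclidean_jordan_algebra set \<Rightarrow> 'a \<Rightarrow> 'a" where
  "subspace_proj M x = (THE p. p \<in> M \<and> (\<forall>q\<in>M. trace_inner (x - p) q = 0))"

definition cond_measure :: "'a::euclidean_jordan_algebra set \<Rightarrow> real" where
  "cond_measure M = (GREATEST d. \<exists>x \<in> M \<inter> sym_cone.
     (frob_norm x)\<^sup>2 = real (jrank TYPE('a)) \<and> d = jdet x)"

definition quad_map :: "'a::euclidean_jordan_algebra \<Rightarrow> 'a \<Rightarrow> 'a" where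
  "quad_map v x = 2 *\<^sub>R (v \<circ>\<^sub>J (v \<circ>\<^sub>J x)) - (v \<circ>\<^sub>J v) \<circ>\<^sub>J x"

(* The postcondition of the basic procedure, run with the projection P. *)
definition basic_output :: "('a::euclidean_jordan_algebra \<Rightarrow> 'a) \<Rightarrow> 'a \<Rightarrow> bool" where
  "basic_output P z \<longleftrightarrow> z \<in> closure sym_cone - {0} \<and>
     (P z \<in> sym_cone \<or>
      frob_norm (cone_proj (P z)) \<le> 1 / (4 * real (jrank TYPE('a))) * spec_norm z)"

(* Basic n D P: the basic procedure is about to be called, after n completed main iterations.
   Rescale n D P z: it has returned z, and the rescaling step is about to be performed.
   Halted n x: x has been returned after n main iterations. *)
datatype 'a config =
    Basic nat "'a \<Rightarrow> 'a" "'a \<Rightarrow> 'a"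
  | Rescale nat "'a \<Rightarrow> 'a" "'a \<Rightarrow> 'a" 'a
  | Halted nat 'a

definition alg_init :: "'a::euclidean_jordan_algebra set \<Rightarrow> 'a config" where
  "alg_init L = Basic 0 id (subspace_proj L)"

(* Nondeterministic: the result z of the basic procedure and the idempotent c are arbitrary
   subject to their specifications, so a claim about all runs covers every implementation. *)
inductive alg_step ::
  "'a::euclidean_jordan_algebra set \<Rightarrow> 'a config \<Rightarrow> 'a config \<Rightarrow> bool" for L where
  halt: "basic_output P z \<Longrightarrow> P z \<in> sym_cone \<Longrightarrow>
    alg_step L (Basic n D P) (Halted n (inv D (P z)))"
| continue: "basic_output P z \<Longrightarrow> P z \<notin> sym_cone \<Longrightarrow>
    alg_step L (Basic n D P) (Rescale n D P z)"
| rescale: "primitive_idempotent c \<Longrightarrow> z \<circ>\<^sub>J c = eigmax z *\<^sub>R c \<Longrightarrow>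
    v = junit + (sqrt 2 - 1) *\<^sub>R c \<Longrightarrow> D' = quad_map v \<circ> D \<Longrightarrow>
    alg_step L (Rescale n D P z) (Basic (Suc n) D' (subspace_proj (D' ` L)))"

end

theory Submission
  imports Defs "HOL-Computational_Algebra.Fundamental_Theorem_Algebra"
begin

text \<open>Fix $x_0 \in L \cap \Omega$ maximising the scale invariant $\det(x) / (\|x\|_F / \sqrt r)^r$,
  which is at most $1$ on $\Omega$ by the inequality of arithmetic and geometric means, and follow
  $y = D x_0$. If the basic procedure returns $z$ and $z \circ c = \lambda_{\max}(z) c$, then
  $z - \lambda_{\max}(z) c$ lies in the closed cone, so that $\lambda_{\max}(z) \langle c, y\rangle \le
  \langle z, y\rangle = \langle Pz, y\rangle \le \|(Pz)^+\|_F \|y\|_F$, that is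
  $\langle c, y\rangle \le \|y\|_F / (4r)$. With $v = e + (\sqrt 2 - 1) c$ the determinant of $D_v y$ is
  $2 \det y$, whereas $\|D_v y\|_F \le \|y\|_F (1 + 1/(4r))$. Hence each main iteration multiplies the
  invariant by at least $2 / e^{1/4} > 3/2$.

  For the trace form, $2 c(cx) - cx = (B(c,x) / B(c,c)) c$ for every primitive $c$ and every
  associative form $B$. Pairing this with a second primitive $d$ gives $B(c,c) = B(d,d)$ unless
  $cd = 0$, so rescaling $B$ on each class of primitives yields an associative form for which all
  primitives have length $1$; it is the trace form.\<close>

subsection \<open>Power associativity\<close>

text \<open>\<open>jtrace\<close>, \<open>jdet\<close> and \<open>eigmax\<close> read off
  eigenvalues picked by \<open>SOME\<close>, so neither linearity of the trace nor any rule for the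
  determinant is available at first, and the spectral theorem itself has to come from the axioms.
  Its source is formal reality: a positive associative form excludes nilpotents and non-real roots
  from the relations satisfied by one element. The determinant is never treated as a polynomial.
  Only \<open>ln (jdet x)\<close> occurs, a sum over eigenvalues, and elements with different frames
  are compared through the doubly stochastic matrix of trace products of the two frames. That yields
  only an upper bound, exact to first order; since it can be applied from every point of the path of
  maps with v = e + (t-1)c, in both directions of t, it fixes the factor t^2. The choice a = sqrt 2
  - 1 means t^2 = 2. The norm estimate rests on <y, cy> = <y^2, c> <= |y| <c, y>, which bounds the
  new squared norm by (|y| + <c, y>)^2. The rate 1.5 is 2 / (4/3), with 4/3 a rational upper bound
  of e^(1/4). No run gets stuck, because D x0 is an admissible answer of the basic procedure at
  every stage.\<close>

lemma linear_jprod_left: "linear (\<lambda>x. x \<circ>\<^sub>J y)"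
  and linear_jprod_right: "linear (\<lambda>y. x \<circ>\<^sub>J y)"
  for x y :: "'a::euclidean_jordan_algebra"
  using bilinear_jprod[where 'a='a] by (auto simp: bilinear_def)

lemma jprod_add_right: "x \<circ>\<^sub>J (y + z) = x \<circ>\<^sub>J y + x \<circ>\<^sub>J z"
  for x :: "'a::euclidean_jordan_algebra"
  using linear_add[OF linear_jprod_right] .

lemma jprod_scaleR_right: "x \<circ>\<^sub>J (s *\<^sub>R y) = s *\<^sub>R (x \<circ>\<^sub>J y)"
  for x :: "'a::euclidean_jordan_algebra"
  using linear_scale[OF linear_jprod_right] .

lemma jprod_diff_left: "(x - y) \<circ>\<^sub>J z = x \<circ>\<^sub>J z - y \<circ>\<^sub>J z"
  for x :: "'a::euclidean_jordan_algebra"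
  using linear_diff[OF linear_jprod_left] .

lemma jprod_diff_right: "x \<circ>\<^sub>J (y - z) = x \<circ>\<^sub>J y - x \<circ>\<^sub>J z"
  for x :: "'a::euclidean_jordan_algebra"
  using linear_diff[OF linear_jprod_right] .

lemma jprod_sum_left: "(\<Sum>i\<in>A. f i) \<circ>\<^sub>J y = (\<Sum>i\<in>A. f i \<circ>\<^sub>J y)"
  for y :: "'a::euclidean_jordan_algebra"
  using linear_sum[OF linear_jprod_left] .

lemma jprod_sum_right: "y \<circ>\<^sub>J (\<Sum>i\<in>A. f i) = (\<Sum>i\<in>A. y \<circ>\<^sub>J f i)"
  for y :: "'a::euclidean_jordan_algebra"
  using linear_sum[OF linear_jprod_right] .

lemma jprod_zero [simp]: "0 \<circ>\<^sub>J x = 0" "x \<circ>\<^sub>J 0 = 0"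
  for x :: "'a::euclidean_jordan_algebra"
  using linear_0[OF linear_jprod_left] linear_0[OF linear_jprod_right] by auto

lemma jprod_unit_left [simp]: "junit \<circ>\<^sub>J x = x"
  for x :: "'a::euclidean_jordan_algebra"
  by (subst jprod_commute) (rule jprod_unit)

declare jprod_unit [simp]

lemmas jprod_simps = jprod_add_left jprod_add_right jprod_diff_left jprod_diff_right
  jprod_scaleR_left jprod_scaleR_right

text \<open>Polarisation: both sides of the Jordan identity are cubic in x, and the
  inclusion-exclusion sum over a, b, c isolates the part that is linear in each. Commutativity makes
  the six permutations pair up, hence the factor 2.\<close>

lemma jordan_identity_linearised:
  fixes a b c d :: "'a::euclidean_jordan_algebra"
  shows "a \<circ>\<^sub>J ((b \<circ>\<^sub>J c) \<circ>\<^sub>J d) + b \<circ>\<^sub>J ((c \<circ>\<^sub>J a) \<circ>\<^sub>J d) + c \<circ>\<^sub>J ((a \<circ>\<^sub>J b) \<circ>\<^sub>J d)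
    = (b \<circ>\<^sub>J c) \<circ>\<^sub>J (a \<circ>\<^sub>J d) + (c \<circ>\<^sub>J a) \<circ>\<^sub>J (b \<circ>\<^sub>J d) + (a \<circ>\<^sub>J b) \<circ>\<^sub>J (c \<circ>\<^sub>J d)"
proof -
  define F where "F x = x \<circ>\<^sub>J ((x \<circ>\<^sub>J x) \<circ>\<^sub>J d) - (x \<circ>\<^sub>J x) \<circ>\<^sub>J (x \<circ>\<^sub>J d)" for x
  have "F x = 0" for x
    by (simp add: F_def jordan_identity)
  then have "F (a + b + c) - F (a + b) - F (b + c) - F (a + c) + F a + F b + F c = 0"
    by simp
  moreover have "F (a + b + c) - F (a + b) - F (b + c) - F (a + c) + F a + F b + F c =
    2 *\<^sub>R ((a \<circ>\<^sub>J ((b \<circ>\<^sub>J c) \<circ>\<^sub>J d) + b \<circ>\<^sub>J ((c \<circ>\<^sub>J a) \<circ>\<^sub>J d) + c \<circ>\<^sub>J ((a \<circ>\<^sub>J b) \<circ>\<^sub>J d))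
    - ((b \<circ>\<^sub>J c) \<circ>\<^sub>J (a \<circ>\<^sub>J d) + (c \<circ>\<^sub>J a) \<circ>\<^sub>J (b \<circ>\<^sub>J d) + (a \<circ>\<^sub>J b) \<circ>\<^sub>J (c \<circ>\<^sub>J d)))"
    by (simp add: F_def jprod_simps jprod_commute[of b a] jprod_commute[of c a]
        jprod_commute[of c b] scaleR_2 algebra_simps)
  ultimately show ?thesis
    by simp
qed

text \<open>The linearised identity read as an operator equation with argument a: multiplication by
  (bc)d is expressed by multiplications by b, c, d and their pairwise products.\<close>

lemma jprod_triple:
  fixes a b c d :: "'a::euclidean_jordan_algebra"
  shows "((b \<circ>\<^sub>J c) \<circ>\<^sub>J d) \<circ>\<^sub>J a = (b \<circ>\<^sub>J c) \<circ>\<^sub>J (d \<circ>\<^sub>J a) + (b \<circ>\<^sub>J d) \<circ>\<^sub>J (c \<circ>\<^sub>J a)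
    + (c \<circ>\<^sub>J d) \<circ>\<^sub>J (b \<circ>\<^sub>J a) - b \<circ>\<^sub>J (d \<circ>\<^sub>J (c \<circ>\<^sub>J a)) - c \<circ>\<^sub>J (d \<circ>\<^sub>J (b \<circ>\<^sub>J a))"
  using jordan_identity_linearised[of a b c d]
  by (simp add: jprod_commute[of a] jprod_commute[of "b \<circ>\<^sub>J a" d] jprod_commute[of "c \<circ>\<^sub>J a" d]
      jprod_commute[of "c \<circ>\<^sub>J a" "b \<circ>\<^sub>J d"] jprod_commute[of "c \<circ>\<^sub>J d" "b \<circ>\<^sub>J a"]
      algebra_simps)

text \<open>With b = d = x and c = x^m, \<open>jprod_triple\<close> writes multiplication by x^(m+2)
  through those by x^(m+1), x^m, x^2 and x. All of these commute with multiplication by x and by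
  x^2, by induction and the Jordan identity.\<close>

lemma jpow_commutes:
  fixes x y :: "'a::euclidean_jordan_algebra"
  shows "jpow x n \<circ>\<^sub>J (x \<circ>\<^sub>J y) = x \<circ>\<^sub>J (jpow x n \<circ>\<^sub>J y) \<and>
    jpow x n \<circ>\<^sub>J ((x \<circ>\<^sub>J x) \<circ>\<^sub>J y) = (x \<circ>\<^sub>J x) \<circ>\<^sub>J (jpow x n \<circ>\<^sub>J y)"
proof (induction n arbitrary: y rule: less_induct)
  case (less n)
  note J = jordan_identity[of x]
  consider "n = 0" | "n = 1" | m where "n = Suc (Suc m)"
    by (metis One_nat_def not0_implies_Suc)
  then show ?case
  proof cases
    case 3
    have L: "jpow x n \<circ>\<^sub>J w = 2 *\<^sub>R (jpow x (Suc m) \<circ>\<^sub>J (x \<circ>\<^sub>J w)) + (x \<circ>\<^sub>J x) \<circ>\<^sub>J (jpow x m \<circ>\<^sub>J w)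
        - x \<circ>\<^sub>J (x \<circ>\<^sub>J (jpow x m \<circ>\<^sub>J w)) - jpow x m \<circ>\<^sub>J (x \<circ>\<^sub>J (x \<circ>\<^sub>J w))" for w
      using jprod_triple[of x "jpow x m" x w]
      by (simp add: 3 jprod_commute[of x "x \<circ>\<^sub>J jpow x m"] jprod_commute[of "jpow x m" x] scaleR_2)
    have A: "jpow x m \<circ>\<^sub>J (x \<circ>\<^sub>J w) = x \<circ>\<^sub>J (jpow x m \<circ>\<^sub>J w)"
      "jpow x m \<circ>\<^sub>J ((x \<circ>\<^sub>J x) \<circ>\<^sub>J w) = (x \<circ>\<^sub>J x) \<circ>\<^sub>J (jpow x m \<circ>\<^sub>J w)"
      "jpow x (Suc m) \<circ>\<^sub>J (x \<circ>\<^sub>J w) = x \<circ>\<^sub>J (jpow x (Suc m) \<circ>\<^sub>J w)"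
      "jpow x (Suc m) \<circ>\<^sub>J ((x \<circ>\<^sub>J x) \<circ>\<^sub>J w) = (x \<circ>\<^sub>J x) \<circ>\<^sub>J (jpow x (Suc m) \<circ>\<^sub>J w)" for w
      using less.IH[of m] less.IH[of "Suc m"] 3 by auto
    show ?thesis
      unfolding L by (simp add: A J jprod_simps del: jpow.simps)
  qed (auto simp: J)
qed

definition jpoly :: "'a::euclidean_jordan_algebra \<Rightarrow> real poly \<Rightarrow> 'a" where
  "jpoly x p = (\<Sum>i\<le>degree p. coeff p i *\<^sub>R jpow x i)"

lemma jpoly_bound:
  assumes "degree p \<le> n"
  shows "jpoly x p = (\<Sum>i\<le>n. coeff p i *\<^sub>R jpow x i)"
  unfolding jpoly_def using assms
  by (intro sum.mono_neutral_left) (auto simp: coeff_eq_0)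

lemma jpoly_0 [simp]: "jpoly x 0 = 0"
  by (simp add: jpoly_def)

lemma jpoly_1 [simp]: "jpoly x 1 = junit"
  by (simp add: jpoly_def)

lemma jpoly_X: "jpoly x [:0, 1:] = x"
  by (simp add: jpoly_def)

lemma jpoly_add: "jpoly x (p + q) = jpoly x p + jpoly x q"
proof -
  let ?n = "max (degree p) (degree q)"
  show ?thesis
    using jpoly_bound[of p ?n x] jpoly_bound[of q ?n x] jpoly_bound[of "p + q" ?n x]
    by (simp add: degree_add_le_max scaleR_add_left sum.distrib)
qed

lemma jpoly_smult: "jpoly x (smult s p) = s *\<^sub>R jpoly x p"
  using jpoly_bound[of "smult s p" "degree p" x]
  by (simp add: degree_smult_le jpoly_def scaleR_sum_right)

lemma jpoly_diff: "jpoly x (p - q) = jpoly x p - jpoly x q"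
proof -
  have "jpoly x (p + smult (-1) q) = jpoly x p - jpoly x q"
    unfolding jpoly_add jpoly_smult by simp
  then show ?thesis by simp
qed

lemma jpoly_sum: "jpoly x (\<Sum>i\<in>A. f i) = (\<Sum>i\<in>A. jpoly x (f i))"
  by (induction A rule: infinite_finite_induct) (auto simp: jpoly_add)

lemma jpoly_pCons: "jpoly x (pCons a p) = a *\<^sub>R junit + x \<circ>\<^sub>J jpoly x p"
proof -
  have "jpoly x (pCons a p) = (\<Sum>i\<le>Suc (degree p). coeff (pCons a p) i *\<^sub>R jpow x i)"
    by (rule jpoly_bound) (simp add: degree_pCons_le)
  also have "\<dots> = a *\<^sub>R junit + x \<circ>\<^sub>J jpoly x p"
    by (simp add: sum.atMost_Suc_shift jpoly_def jprod_sum_right jprod_scaleR_right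
        del: sum.atMost_Suc)
  finally show ?thesis .
qed

lemma jpoly_commutes: "x \<circ>\<^sub>J (jpoly x p \<circ>\<^sub>J y) = jpoly x p \<circ>\<^sub>J (x \<circ>\<^sub>J y)"
  using jpow_commutes[of x]
  by (simp add: jpoly_def jprod_sum_left jprod_sum_right jprod_scaleR_left jprod_scaleR_right)

text \<open>This is power associativity: peeling one factor x off p only requires that
  multiplications by x and by q(x) commute.\<close>

lemma jpoly_mult: "jpoly x (p * q) = jpoly x p \<circ>\<^sub>J jpoly x q"
proof (induction p)
  case (pCons a p)
  have "x \<circ>\<^sub>J (jpoly x p \<circ>\<^sub>J jpoly x q) = (x \<circ>\<^sub>J jpoly x p) \<circ>\<^sub>J jpoly x q"
    using jpoly_commutes[of x q "jpoly x p"]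
    by (simp add: jprod_commute[of _ "jpoly x q"])
  then show ?case
    by (simp add: jpoly_add jpoly_smult jpoly_pCons pCons.IH jprod_simps)
qed simp

subsection \<open>Associative forms and the spectral theorem\<close>

text \<open>Used twice: first for the unknown form that the class provides, later for
  \<open>trace_inner\<close>, once the former has shown that the latter is such a form.\<close>

locale assoc_form =
  fixes B :: "'a::euclidean_jordan_algebra \<Rightarrow> 'a \<Rightarrow> real"
  assumes form_add_left: "B (x + y) z = B x z + B y z"
    and form_add_right: "B x (y + z) = B x y + B x z"
    and form_scaleR_left: "B (s *\<^sub>R x) y = s * B x y"
    and form_scaleR_right: "B x (s *\<^sub>R y) = s * B x y"
    and form_assoc: "B (x \<circ>\<^sub>J y) z = B x (y \<circ>\<^sub>J z)"
    and form_pos: "x \<noteq> 0 \<Longrightarrow> B x x > 0"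
begin

lemma linear_form_left: "linear (\<lambda>x. B x y)" and linear_form_right: "linear (B x)"
  by (auto intro!: linearI simp: form_add_left form_add_right form_scaleR_left form_scaleR_right)

lemma form_zero [simp]: "B 0 x = 0" "B x 0 = 0"
  using linear_0[OF linear_form_left] linear_0[OF linear_form_right] by auto

lemma form_diff_left: "B (x - y) z = B x z - B y z"
  using linear_diff[OF linear_form_left] .

lemma form_diff_right: "B x (y - z) = B x y - B x z"
  using linear_diff[OF linear_form_right] .

lemma form_sum_left: "B (\<Sum>i\<in>A. f i) y = (\<Sum>i\<in>A. B (f i) y)"
  using linear_sum[OF linear_form_left] .

lemma form_sum_right: "B y (\<Sum>i\<in>A. f i) = (\<Sum>i\<in>A. B y (f i))"
  using linear_sum[OF linear_form_right] .

lemmas form_simps = form_add_left form_add_right form_diff_left form_diff_right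
  form_scaleR_left form_scaleR_right

text \<open>Both sides are the pairing of the product of x and y with \<open>junit\<close>.\<close>

lemma form_commute: "B x y = B y x"
  by (metis form_assoc jprod_commute jprod_unit)

lemma form_nonneg: "B x x \<ge> 0"
  using form_pos[of x] by (cases "x = 0") auto

lemma form_eq_0_iff: "B x x = 0 \<longleftrightarrow> x = 0"
  using form_pos[of x] by (metis form_zero(1) less_irrefl)

lemma form_Cauchy_Schwarz: "(B x y)\<^sup>2 \<le> B x x * B y y"
proof (cases "y = 0")
  case False
  have "0 \<le> B (B y y *\<^sub>R x - B x y *\<^sub>R y) (B y y *\<^sub>R x - B x y *\<^sub>R y)"
    by (rule form_nonneg)
  also have "\<dots> = B y y * (B x x * B y y - (B x y)\<^sup>2)"
    by (simp add: form_simps form_commute[of y x] algebra_simps power2_eq_square)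
  finally have "0 \<le> B x x * B y y - (B x y)\<^sup>2"
    using form_pos[OF False] mult_pos_neg by (meson not_le)
  then show ?thesis by simp
qed simp

lemma form_unit: "B (x \<circ>\<^sub>J y) junit = B x y"
  by (simp add: form_assoc)

end

lemma assoc_form_exists: "\<exists>B :: 'a::euclidean_jordan_algebra \<Rightarrow> 'a \<Rightarrow> real. assoc_form B"
  using associative_form by (rule ex_forward) (simp add: assoc_form_def)

text \<open>Formal reality: pairing a square with \<open>junit\<close> gives \<open>B x x\<close>,
  so two squares cannot cancel.\<close>

lemma jsquare_add_eq_0:
  fixes x y :: "'a::euclidean_jordan_algebra"
  assumes "x \<circ>\<^sub>J x + y \<circ>\<^sub>J y = 0"
  shows "x = 0" "y = 0"
proof -
  obtain B :: "'a \<Rightarrow> 'a \<Rightarrow> real" where "assoc_form B"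
    using assoc_form_exists by blast
  then interpret assoc_form B .
  have "B x x + B y y = B (x \<circ>\<^sub>J x + y \<circ>\<^sub>J y) junit"
    by (simp add: form_add_left form_unit)
  then have "B x x + B y y = 0"
    by (simp add: assms)
  then show "x = 0" "y = 0"
    using form_nonneg[of x] form_nonneg[of y] form_eq_0_iff by (metis add_nonneg_eq_0_iff)+
qed

section \<open>Annihilating polynomials of one element\<close>

lemma jpoly_sum_squares_eq_0:
  assumes "jpoly x (p * p + q * q) = 0"
  shows "jpoly x p = 0" "jpoly x q = 0"
proof -
  have "jpoly x p \<circ>\<^sub>J jpoly x p + jpoly x q \<circ>\<^sub>J jpoly x q = 0"
    using assms by (simp add: jpoly_add jpoly_mult)
  then show "jpoly x p = 0" "jpoly x q = 0"
    by (rule jsquare_add_eq_0)+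
qed

text \<open>A complex root z is real or yields the factor (X - Re z)^2 + (Im z)^2. That factor is
  kept as a sum of squares because formal reality will be applied to it.\<close>

lemma real_poly_root_or_quadratic_factor:
  fixes p :: "real poly"
  assumes "degree p > 0"
  obtains s q where "p = [:- s, 1:] * q"
  | a b q where "b \<noteq> 0" "p = ([:- a, 1:] * [:- a, 1:] + [:b:] * [:b:]) * q"
proof -
  define C where "C = map_poly complex_of_real"
  have C_pCons: "C (pCons a f) = pCons (complex_of_real a) (C f)" for a f
    by (simp add: C_def map_poly_pCons)
  have C0: "C 0 = 0"
    by (simp add: C_def)
  have C_add: "C (f + g) = C f + C g" for f g
    by (intro poly_eqI) (simp add: C_def coeff_map_poly)
  have C_mult: "C (f * g) = C f * C g" for f g
    by (intro poly_eqI) (simp add: C_def coeff_map_poly coeff_mult)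
  have "degree (C p) = degree p"
    by (simp add: C_def degree_map_poly)
  then obtain z where z: "poly (C p) z = 0"
    using assms fundamental_theorem_of_algebra constant_degree by (metis less_numeral_extra(3))
  show thesis
  proof (cases "Im z = 0")
    case True
    then have "z = complex_of_real (Re z)"
      by (simp add: complex_eq_iff)
    moreover have "poly (C p) (complex_of_real s) = complex_of_real (poly p s)" for s
      by (induction p) (simp_all add: C_pCons C0)
    ultimately have "poly p (Re z) = 0"
      using z by (metis of_real_eq_0_iff)
    then show ?thesis
      using that(1) by (metis poly_eq_0_iff_dvd dvdE)
  next
    case False
    define Q where "Q = [:- Re z, 1:] * [:- Re z, 1:] + [:Im z:] * [:Im z:]"
    have Q: "Q = [:(Re z)\<^sup>2 + (Im z)\<^sup>2, - 2 * Re z, 1:]"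
      by (simp add: Q_def power2_eq_square)
    have Qz: "poly (C Q) z = 0"
      by (simp add: Q C_pCons C0 complex_eq_iff power2_eq_square algebra_simps)
    have "degree (p mod Q) < 2"
      using degree_mod_less'[of Q p] by (cases "p mod Q = 0") (auto simp: Q)
    then obtain c0 c1 where c: "p mod Q = [:c0, c1:]"
    proof -
      have "p mod Q = [:coeff (p mod Q) 0, coeff (p mod Q) 1:]"
        using \<open>degree (p mod Q) < 2\<close>
        by (intro poly_eqI) (auto simp: coeff_pCons coeff_eq_0 split: nat.splits)
      then show ?thesis
        using that by blast
    qed
    have "C p = C (p div Q) * C Q + C (p mod Q)"
      by (simp flip: C_mult C_add)
    then have "poly (C (p mod Q)) z = 0"
      using z Qz by simp
    \<comment> \<open>A real polynomial of degree at most one with a non-real root is zero.\<close>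
    then have "p mod Q = 0"
      using False by (auto simp: c C_pCons C0 complex_eq_iff)
    then have "p = Q * (p div Q)"
      using mult_div_mod_eq[of Q p] by simp
    then show ?thesis
      using that(2) False unfolding Q_def by blast
  qed
qed

text \<open>A one-variable real Nullstellensatz: multiplicities and non-real roots of an
  annihilating polynomial are irrelevant. The induction removes factors of p; a linear factor is
  moved into the auxiliary g, a quadratic one disappears by formal reality.\<close>

lemma jpoly_mult_eq_0:
  assumes "p \<noteq> 0" "jpoly x (p * g) = 0" "\<And>s. poly p s = 0 \<Longrightarrow> poly f s = 0"
  shows "jpoly x (f * g) = 0"
  using assms
proof (induction "degree p" arbitrary: p g rule: less_induct)
  case less
  show ?case
  proof (cases "degree p = 0")
    case True
    then obtain c where c: "p = [:c:]" "c \<noteq> 0"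
      using less.prems(1) by (metis degree_eq_zeroE pCons_0_0)
    then have "jpoly x g = 0"
      using less.prems(2) by (simp add: jpoly_smult)
    then show ?thesis
      by (simp add: jpoly_mult)
  next
    case False
    then have "degree p > 0"
      by simp
    then show ?thesis
    proof (cases rule: real_poly_root_or_quadratic_factor)
      case (1 s q)
      have "q \<noteq> 0"
        using 1 less.prems(1) by (metis mult_zero_right)
      then have "degree p = degree [:- s, 1:] + degree q"
        unfolding 1 by (intro degree_mult_eq) auto
      then have "degree q < degree p"
        by simp
      moreover have "jpoly x (q * ([:- s, 1:] * g)) = 0"
        using less.prems(2) by (simp only: 1 mult_ac)
      moreover have "poly f t = 0" if "poly q t = 0" for t
        using that by (intro less.prems(3)) (simp only: 1 poly_mult mult_zero_right)
      ultimately have "jpoly x (f * ([:- s, 1:] * g)) = 0"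
        using \<open>q \<noteq> 0\<close> less.hyps[of q "[:- s, 1:] * g"] by blast
      moreover have "poly f s = 0"
        by (intro less.prems(3)) (simp add: 1)
      then obtain h where h: "f = [:- s, 1:] * h"
        by (metis poly_eq_0_iff_dvd dvdE)
      ultimately have "jpoly x ((f * ([:- s, 1:] * g)) * (h * g)) = 0"
        unfolding jpoly_mult[of x "f * ([:- s, 1:] * g)"] by (simp only: jprod_zero)
      \<comment> \<open>Since f = (X - s) h, the product is the square of f g; the summand 0 * 0
        gives it the shape of a sum of two squares.\<close>
      also have "(f * ([:- s, 1:] * g)) * (h * g) = f * g * (f * g) + 0 * 0"
        by (simp only: h mult_ac mult_zero_left add_0_right)
      finally show ?thesis
        by (rule jpoly_sum_squares_eq_0)
    next
      case (2 a b q)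
      define Q where "Q = [:- a, 1:] * [:- a, 1:] + [:b:] * [:b:]"
      have "Q = [:a * a + b * b, - 2 * a, 1:]"
        by (simp add: Q_def)
      then have "degree Q = 2"
        by simp
      have p: "p = Q * q"
        unfolding Q_def by (rule 2(2))
      have "q \<noteq> 0"
        using p less.prems(1) by (metis mult_zero_right)
      then have "degree p = 2 + degree q"
        unfolding p using \<open>degree Q = 2\<close> by (subst degree_mult_eq) auto
      then have "degree q < degree p"
        by simp
      \<comment> \<open>Another factor q g turns p g = Q q g into Q (q g)^2, a sum of two
        squares.\<close>
      have "jpoly x (p * g * (q * g)) = 0"
        unfolding jpoly_mult[of x "p * g"] less.prems(2) by simp
      also have "p * g * (q * g) = ([:- a, 1:] * (q * g)) * ([:- a, 1:] * (q * g))
          + ([:b:] * (q * g)) * ([:b:] * (q * g))"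
        by (simp only: p Q_def distrib_left distrib_right mult_ac)
      finally have "jpoly x ([:b:] * (q * g)) = 0"
        by (rule jpoly_sum_squares_eq_0)
      then have "jpoly x (q * g) = 0"
        using 2(1) by (simp add: jpoly_smult)
      moreover have "poly f t = 0" if "poly q t = 0" for t
        using that by (intro less.prems(3)) (simp only: p poly_mult mult_zero_right)
      ultimately show ?thesis
        using \<open>q \<noteq> 0\<close> \<open>degree q < degree p\<close> less.hyps[of q g] by blast
    qed
  qed
qed

text \<open>Linear dependence in the library is a property of sets. Coinciding powers are therefore
  treated apart; they give the relation X^i - X^j.\<close>

lemma powers_dependent:
  fixes x :: "'a::euclidean_jordan_algebra"
  shows "\<exists>p. p \<noteq> 0 \<and> jpoly x p = 0"
proof (cases "inj_on (jpow x) {..DIM('a)}")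
  case True
  have "dependent (jpow x ` {..DIM('a)})"
    by (rule dependent_biggerset) (simp add: card_image[OF True])
  then obtain u v where u: "(\<Sum>v\<in>jpow x ` {..DIM('a)}. u v *\<^sub>R v) = 0"
    "v \<in> jpow x ` {..DIM('a)}" "u v \<noteq> 0"
    using dependent_finite[of "jpow x ` {..DIM('a)}"] by auto
  define p where "p = (\<Sum>i\<le>DIM('a). monom (u (jpow x i)) i)"
  have c: "coeff p i = (if i \<le> DIM('a) then u (jpow x i) else 0)" for i
    by (simp add: p_def coeff_sum)
  then have "degree p \<le> DIM('a)"
    by (intro degree_le) auto
  then have "jpoly x p = (\<Sum>i\<le>DIM('a). coeff p i *\<^sub>R jpow x i)"
    by (rule jpoly_bound)
  also have "\<dots> = (\<Sum>v\<in>jpow x ` {..DIM('a)}. u v *\<^sub>R v)"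
    by (simp add: c sum.reindex[OF True])
  finally have "jpoly x p = 0"
    using u by simp
  moreover have "p \<noteq> 0"
    using u(2,3) c by (metis (mono_tags, lifting) atMost_iff coeff_0 imageE)
  ultimately show ?thesis by blast
next
  case False
  then obtain i j where ij: "i \<noteq> j" "jpow x i = jpow x j"
    by (auto simp: inj_on_def)
  define p :: "real poly" where "p = monom 1 i - monom 1 j"
  have m: "jpoly x (monom 1 k) = jpow x k" for k
    by (induction k) (auto simp: monom_0 monom_Suc jpoly_pCons)
  have "coeff p i \<noteq> 0"
    using ij by (simp add: p_def)
  then have "p \<noteq> 0"
    by auto
  moreover have "jpoly x p = 0"
    by (simp add: p_def jpoly_diff m ij)
  ultimately show ?thesis by blast
qed

text \<open>S is the real root set of one annihilating polynomial. It may contain numbers that are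
  not eigenvalues of x; their spectral idempotents will be zero.\<close>

lemma jpoly_vanishing_set:
  obtains S where "finite S" "\<And>f. (\<And>s. s \<in> S \<Longrightarrow> poly f s = 0) \<Longrightarrow> jpoly x f = 0"
proof -
  obtain p where p: "p \<noteq> 0" "jpoly x p = 0"
    using powers_dependent by blast
  show thesis
  proof (rule that)
    show "finite {s. poly p s = 0}"
      using p poly_roots_finite by blast
    show "jpoly x f = 0" if "\<And>s. s \<in> {s. poly p s = 0} \<Longrightarrow> poly f s = 0" for f
      using jpoly_mult_eq_0[of p x 1 f] p that by simp
  qed
qed

text \<open>The $c_s$ are the values at $x$ of the Lagrange interpolation polynomials of a finite set
  on which every annihilating polynomial may be tested.\<close>

lemma spectral_idempotents:
  fixes x :: "'a::euclidean_jordan_algebra"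
  obtains S and c :: "real \<Rightarrow> 'a" where "finite S" "\<And>s. s \<in> S \<Longrightarrow> idempotent (c s)"
    "\<And>s t. s \<in> S \<Longrightarrow> t \<in> S \<Longrightarrow> s \<noteq> t \<Longrightarrow> c s \<circ>\<^sub>J c t = 0"
    "(\<Sum>s\<in>S. c s) = junit" "x = (\<Sum>s\<in>S. s *\<^sub>R c s)"
proof -
  obtain S where S: "finite S" "\<And>f. (\<And>s. s \<in> S \<Longrightarrow> poly f s = 0) \<Longrightarrow> jpoly x f = 0"
    using jpoly_vanishing_set by blast
  have eq: "jpoly x f = jpoly x g" if "\<And>s. s \<in> S \<Longrightarrow> poly f s = poly g s" for f g
    using S(2)[of "f - g"] that by (simp add: jpoly_diff)
  define P :: "real \<Rightarrow> real poly"
    where "P s = (\<Prod>t\<in>S - {s}. smult (1 / (s - t)) [:- t, 1:])" for s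
  have P: "poly (P s) t = (if s = t then 1 else 0)" if "s \<in> S" "t \<in> S" for s t
  proof (cases "s = t")
    case True
    then show ?thesis
      by (auto simp: P_def poly_prod intro!: prod.neutral simp flip: diff_divide_distrib)
  next
    case False
    then show ?thesis
      using that S(1) by (auto simp: P_def poly_prod intro!: bexI[of _ t])
  qed
  show thesis
  proof (rule that[of S "\<lambda>s. jpoly x (P s)"])
    show "finite S" by fact
    show "idempotent (jpoly x (P s))" if "s \<in> S" for s
      unfolding idempotent_def jpoly_mult[symmetric] using that by (intro eq) (simp add: P)
    show "jpoly x (P s) \<circ>\<^sub>J jpoly x (P t) = 0" if "s \<in> S" "t \<in> S" "s \<noteq> t" for s t
      unfolding jpoly_mult[symmetric] using that by (intro S) (auto simp: P)
    have "(\<Sum>s\<in>S. jpoly x (P s)) = jpoly x 1"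
      unfolding jpoly_sum[symmetric]
      by (intro eq) (use S(1) in \<open>simp add: poly_sum P if_distrib sum.delta cong: if_cong sum.cong\<close>)
    then show "(\<Sum>s\<in>S. jpoly x (P s)) = junit" by simp
    have "(\<Sum>s\<in>S. s *\<^sub>R jpoly x (P s)) = jpoly x [:0, 1:]"
      unfolding jpoly_sum[symmetric] jpoly_smult[symmetric]
      by (intro eq) (use S(1) in \<open>simp add: poly_sum P if_distrib sum.delta cong: if_cong sum.cong\<close>)
    then show "x = (\<Sum>s\<in>S. s *\<^sub>R jpoly x (P s))"
      by (simp add: jpoly_X)
  qed
qed

section \<open>Idempotents, Peirce rules and primitivity\<close>

lemma idempotentD: "idempotent c \<Longrightarrow> c \<circ>\<^sub>J c = c"
  by (simp add: idempotent_def)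

lemma scaleR_3: "3 *\<^sub>R z = z + z + z" for z :: "'a::real_vector"
  using scaleR_add_left[of 2 1 z] by (simp add: scaleR_2)

text \<open>The relation 2t^3 - 3t^2 + t = t(2t - 1)(t - 1) for multiplication by c, whose roots 0,
  1/2, 1 are the Peirce eigenvalues. It is \<open>jprod_triple\<close> with three arguments
  c.\<close>

lemma idempotent_cubic:
  assumes "idempotent c"
  shows "2 *\<^sub>R (c \<circ>\<^sub>J (c \<circ>\<^sub>J (c \<circ>\<^sub>J y))) = 3 *\<^sub>R (c \<circ>\<^sub>J (c \<circ>\<^sub>J y)) - c \<circ>\<^sub>J y"
  using jprod_triple[of c c c y]
  by (simp add: idempotentD[OF assms] scaleR_2 scaleR_3 algebra_simps)

lemma idempotent_diff_unit: "idempotent c \<Longrightarrow> idempotent (junit - c)"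
  by (simp add: idempotent_def jprod_simps)

text \<open>In the linearised identity with two arguments c and one u, the surviving terms are
  multiples of c(uw) and u(cw) only.\<close>

lemma peirce_one_commutes:
  assumes "idempotent c" "c \<circ>\<^sub>J u = u"
  shows "c \<circ>\<^sub>J (u \<circ>\<^sub>J w) = u \<circ>\<^sub>J (c \<circ>\<^sub>J w)"
  using jordan_identity_linearised[of c c u w]
  by (simp add: idempotentD[OF assms(1)] assms(2) jprod_commute[of u c])

lemma peirce_zero_commutes:
  assumes "idempotent c" "c \<circ>\<^sub>J u = 0"
  shows "c \<circ>\<^sub>J (u \<circ>\<^sub>J w) = u \<circ>\<^sub>J (c \<circ>\<^sub>J w)"
  using jordan_identity_linearised[of c c u w]
  by (simp add: idempotentD[OF assms(1)] assms(2) jprod_commute[of u c])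

text \<open>Both u and w commute with c as multiplications, so c(uw) equals u(cw) = 0 and also w(cu)
  = wu.\<close>

lemma peirce_one_zero_orthogonal:
  assumes "idempotent c" "c \<circ>\<^sub>J u = u" "c \<circ>\<^sub>J w = 0"
  shows "u \<circ>\<^sub>J w = 0"
  using peirce_one_commutes[OF assms(1,2), of w] peirce_zero_commutes[OF assms(1,3), of u]
  by (simp add: assms jprod_commute[of w u])

lemma idempotent_sum_orthogonal:
  assumes "idempotent p" "idempotent q" "idempotent (p + q)"
  shows "p \<circ>\<^sub>J q = 0"
  using assms
  by (simp add: idempotent_def jprod_simps jprod_commute[of q p] flip: scaleR_2)

context assoc_form
begin

lemma form_move: "B (x \<circ>\<^sub>J y) z = B y (x \<circ>\<^sub>J z)"
  by (metis form_assoc jprod_commute)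

text \<open>On the Peirce spaces the left multiplication $L$ by an idempotent has the eigenvalues
  $0, \frac12, 1$, where $L = L^2 + 4 (L - L^2)^2$.\<close>

lemma form_idempotent_mult:
  assumes "idempotent q"
  shows "B (q \<circ>\<^sub>J y) y = B (q \<circ>\<^sub>J y) (q \<circ>\<^sub>J y)
    + 4 * B (q \<circ>\<^sub>J y - q \<circ>\<^sub>J (q \<circ>\<^sub>J y)) (q \<circ>\<^sub>J y - q \<circ>\<^sub>J (q \<circ>\<^sub>J y))"
proof -
  define a b c d where "a = B y (q \<circ>\<^sub>J y)" and "b = B y (q \<circ>\<^sub>J (q \<circ>\<^sub>J y))"
    and "c = B y (q \<circ>\<^sub>J (q \<circ>\<^sub>J (q \<circ>\<^sub>J y)))" and "d = B y (q \<circ>\<^sub>J (q \<circ>\<^sub>J (q \<circ>\<^sub>J (q \<circ>\<^sub>J y))))"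
  have "B y (2 *\<^sub>R (q \<circ>\<^sub>J (q \<circ>\<^sub>J (q \<circ>\<^sub>J y)))) = B y (3 *\<^sub>R (q \<circ>\<^sub>J (q \<circ>\<^sub>J y)) - q \<circ>\<^sub>J y)"
    by (simp only: idempotent_cubic[OF assms])
  then have 1: "2 * c = 3 * b - a"
    by (simp add: form_simps a_def b_def c_def)
  have "B y (2 *\<^sub>R (q \<circ>\<^sub>J (q \<circ>\<^sub>J (q \<circ>\<^sub>J (q \<circ>\<^sub>J y))))) =
      B y (3 *\<^sub>R (q \<circ>\<^sub>J (q \<circ>\<^sub>J (q \<circ>\<^sub>J y))) - q \<circ>\<^sub>J (q \<circ>\<^sub>J y))"
    by (simp only: idempotent_cubic[OF assms])
  then have 2: "2 * d = 3 * c - b"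
    by (simp add: form_simps b_def c_def d_def)
  have "B (q \<circ>\<^sub>J y) y = a" "B (q \<circ>\<^sub>J y) (q \<circ>\<^sub>J y) = b"
    "B (q \<circ>\<^sub>J y - q \<circ>\<^sub>J (q \<circ>\<^sub>J y)) (q \<circ>\<^sub>J y - q \<circ>\<^sub>J (q \<circ>\<^sub>J y)) = b - 2 * c + d"
    by (simp_all add: form_simps form_move a_def b_def c_def d_def)
  then show ?thesis
    using 1 2 by simp
qed

lemma form_idempotent_mult_ge:
  "idempotent q \<Longrightarrow> B (q \<circ>\<^sub>J y) (q \<circ>\<^sub>J y) \<le> B (q \<circ>\<^sub>J y) y"
  using form_idempotent_mult[of q y] form_nonneg
  by (metis add_increasing2 mult_nonneg_nonneg order_refl zero_le_numeral)

text \<open>\<open>B p q\<close> dominates the squared length of the product of p and q.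
  Orthogonality for the form thus becomes orthogonality in the algebra.\<close>

lemma form_idempotents:
  assumes "idempotent p" "idempotent q"
  shows "B p q \<ge> 0" "B p q = 0 \<Longrightarrow> p \<circ>\<^sub>J q = 0"
proof -
  have "B (p \<circ>\<^sub>J q) (p \<circ>\<^sub>J q) \<le> B p q"
    using form_idempotent_mult_ge[OF assms(1), of q]
    by (simp add: form_assoc idempotentD[OF assms(2)])
  moreover have "B (p \<circ>\<^sub>J q) (p \<circ>\<^sub>J q) \<ge> 0"
    by (rule form_nonneg)
  ultimately show "B p q \<ge> 0" "B p q = 0 \<Longrightarrow> p \<circ>\<^sub>J q = 0"
    using form_eq_0_iff[of "p \<circ>\<^sub>J q"] by auto
qed

end

lemma primitive_idempotentD:
  assumes "primitive_idempotent c"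
  shows "idempotent c" "c \<noteq> 0" "c \<circ>\<^sub>J c = c"
  using assms by (auto simp: primitive_idempotent_def idempotent_def)

text \<open>A spectral idempotent e_s of u with s \<noteq> 0 is orthogonal to
  \<open>junit - c\<close>, because u is; hence it is a summand of c, and primitivity leaves only 0
  and c.\<close>

lemma primitive_peirce_one:
  fixes c u :: "'a::euclidean_jordan_algebra"
  assumes "primitive_idempotent c" "c \<circ>\<^sub>J u = u"
  shows "\<exists>l. u = l *\<^sub>R c"
proof -
  obtain B :: "'a \<Rightarrow> 'a \<Rightarrow> real" where "assoc_form B"
    using assoc_form_exists by blast
  then interpret assoc_form B .
  note c = primitive_idempotentD[OF assms(1)]
  obtain S and e :: "real \<Rightarrow> 'a" where S: "finite S" "\<And>s. s \<in> S \<Longrightarrow> idempotent (e s)"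
    "\<And>s t. s \<in> S \<Longrightarrow> t \<in> S \<Longrightarrow> s \<noteq> t \<Longrightarrow> e s \<circ>\<^sub>J e t = 0"
    "(\<Sum>s\<in>S. e s) = junit" and u: "u = (\<Sum>s\<in>S. s *\<^sub>R e s)"
    using spectral_idempotents[of u] by blast
  have "\<exists>k. s *\<^sub>R e s = k *\<^sub>R c" if s: "s \<in> S" for s
  proof (cases "s = 0")
    case False
    have "u \<circ>\<^sub>J e s = (\<Sum>t\<in>S. if t = s then s *\<^sub>R e s else 0)"
      unfolding u jprod_sum_left
      using S s by (intro sum.cong) (auto simp: jprod_scaleR_left idempotent_def)
    then have us: "u \<circ>\<^sub>J e s = s *\<^sub>R e s"
      using S s by simp
    have "s * B (junit - c) (e s) = B ((junit - c) \<circ>\<^sub>J u) (e s)"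
      by (simp add: form_assoc us form_scaleR_right)
    also have "(junit - c) \<circ>\<^sub>J u = 0"
      by (simp add: jprod_diff_left assms(2))
    finally have "B (junit - c) (e s) = 0"
      using False by simp
    then have "(junit - c) \<circ>\<^sub>J e s = 0"
      using form_idempotents(2)[OF idempotent_diff_unit] c S(2)[OF s] by blast
    then have "c \<circ>\<^sub>J e s = e s"
      by (simp add: jprod_diff_left)
    then have "idempotent (c - e s)"
      using c S(2)[OF s] by (simp add: idempotent_def jprod_simps jprod_commute[of "e s" c])
    moreover have "c = e s + (c - e s)"
      by simp
    ultimately have "e s = 0 \<or> c - e s = 0"
      using assms(1) S(2)[OF s] unfolding primitive_idempotent_def by blast
    then show ?thesis
      by (metis eq_iff_diff_eq_0 scaleR_zero_left scaleR_zero_right)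
  qed (auto intro: exI[of _ 0])
  then obtain k where "\<And>s. s \<in> S \<Longrightarrow> s *\<^sub>R e s = k s *\<^sub>R c"
    by metis
  then have "u = (\<Sum>s\<in>S. k s) *\<^sub>R c"
    by (simp add: u scaleR_sum_left)
  then show ?thesis by blast
qed

context assoc_form
begin

text \<open>The left side is the quadratic map of c. By the cubic relation it lies in the Peirce
  space of eigenvalue 1, the line spanned by c; pairing with c gives the coefficient.\<close>

lemma primitive_quad:
  assumes "primitive_idempotent c"
  shows "2 *\<^sub>R (c \<circ>\<^sub>J (c \<circ>\<^sub>J y)) - c \<circ>\<^sub>J y = (B c y / B c c) *\<^sub>R c"
proof -
  note c = primitive_idempotentD[OF assms]
  let ?u = "2 *\<^sub>R (c \<circ>\<^sub>J (c \<circ>\<^sub>J y)) - c \<circ>\<^sub>J y"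
  have "c \<circ>\<^sub>J ?u = ?u"
    using idempotent_cubic[OF c(1), of y]
    by (simp add: jprod_simps scaleR_2 scaleR_3 algebra_simps)
  then obtain l where l: "?u = l *\<^sub>R c"
    using primitive_peirce_one[OF assms] by blast
  have "B c ?u = B c y"
    by (simp add: form_simps form_assoc[symmetric] c)
  moreover have "B c c > 0"
    using form_pos c by simp
  ultimately show ?thesis
    unfolding l by (simp add: form_scaleR_right) (metis nonzero_mult_div_cancel_right less_irrefl)
qed

text \<open>Pairing \<open>primitive_quad\<close> of c with d gives B(c,d)^2 / B(c,c) = 2 B(cd,cd) -
  B(c,d), and the right side is symmetric in c and d.\<close>

lemma primitive_same_length:
  assumes "primitive_idempotent c" "primitive_idempotent d" "c \<circ>\<^sub>J d \<noteq> 0"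
  shows "B c c = B d d"
proof -
  note c = primitive_idempotentD[OF assms(1)] and d = primitive_idempotentD[OF assms(2)]
  have "B c d \<noteq> 0"
    using form_idempotents(2) c(1) d(1) assms(3) by blast
  have move: "B y (x \<circ>\<^sub>J (x \<circ>\<^sub>J y)) = B (x \<circ>\<^sub>J y) (x \<circ>\<^sub>J y)" for x y
    by (simp only: form_move)
  have "B d (2 *\<^sub>R (c \<circ>\<^sub>J (c \<circ>\<^sub>J d)) - c \<circ>\<^sub>J d) = 2 * B (c \<circ>\<^sub>J d) (c \<circ>\<^sub>J d) - B (d \<circ>\<^sub>J d) c"
    by (simp add: form_simps move form_assoc jprod_commute[of d c])
  then have 1: "(B c d)\<^sup>2 / B c c = 2 * B (c \<circ>\<^sub>J d) (c \<circ>\<^sub>J d) - B c d"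
    unfolding primitive_quad[OF assms(1)]
    by (simp add: form_scaleR_right form_commute[of d c] power2_eq_square d)
  have "B c (2 *\<^sub>R (d \<circ>\<^sub>J (d \<circ>\<^sub>J c)) - d \<circ>\<^sub>J c) = 2 * B (d \<circ>\<^sub>J c) (d \<circ>\<^sub>J c) - B (c \<circ>\<^sub>J c) d"
    by (simp add: form_simps move form_assoc jprod_commute[of d c])
  then have 2: "(B c d)\<^sup>2 / B d d = 2 * B (c \<circ>\<^sub>J d) (c \<circ>\<^sub>J d) - B c d"
    unfolding primitive_quad[OF assms(2)]
    by (simp add: form_scaleR_right form_commute[of d c] jprod_commute[of d c] power2_eq_square c)
  have "(B c d)\<^sup>2 / B c c = (B c d)\<^sup>2 / B d d"
    using 1 2 by simp
  then show ?thesis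
    using \<open>B c d \<noteq> 0\<close> by simp
qed

end

text \<open>A set of any size with any sum, whereas \<open>jordan_frame\<close> is indexed by the
  rank; the rank is known only after all complete frames are shown to have the same size.\<close>

definition orthogonal_frame :: "'a::euclidean_jordan_algebra set \<Rightarrow> bool" where
  "orthogonal_frame F \<longleftrightarrow> finite F \<and> (\<forall>c\<in>F. primitive_idempotent c) \<and>
     (\<forall>c\<in>F. \<forall>d\<in>F. c \<noteq> d \<longrightarrow> c \<circ>\<^sub>J d = 0)"

lemma subspace_peirce_one: "subspace {y. p \<circ>\<^sub>J y = y}"
  by (auto simp: subspace_def jprod_add_right jprod_scaleR_right)

lemma orthogonal_frame_Un:
  assumes "orthogonal_frame F" "orthogonal_frame G"
    and orth: "\<And>c d. c \<in> F \<Longrightarrow> d \<in> G \<Longrightarrow> c \<circ>\<^sub>J d = 0"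
  shows "orthogonal_frame (F \<union> G)" "F \<inter> G = {}"
proof -
  have "d \<circ>\<^sub>J c = 0" if "c \<in> F" "d \<in> G" for c d
    using orth[OF that] by (simp add: jprod_commute)
  then show "orthogonal_frame (F \<union> G)"
    using assms by (auto simp: orthogonal_frame_def)
  show "F \<inter> G = {}"
  proof safe
    fix c assume "c \<in> F" "c \<in> G"
    then have "primitive_idempotent c" "c \<circ>\<^sub>J c = 0"
      using assms by (auto simp: orthogonal_frame_def)
    then show "c \<in> {}"
      using primitive_idempotentD[of c] by simp
  qed
qed

text \<open>Induction on the dimension of the Peirce space of eigenvalue 1: if p = a + b, then b
  lies in the space of p but not in that of a. The last clause makes the frames of a and b
  orthogonal to each other.\<close>

lemma idempotent_frame:
  fixes p :: "'a::euclidean_jordan_algebra"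
  assumes "idempotent p"
  shows "\<exists>F. orthogonal_frame F \<and> \<Sum>F = p \<and> (\<forall>c\<in>F. p \<circ>\<^sub>J c = c)"
  using assms
proof (induction "dim {y. p \<circ>\<^sub>J y = y}" arbitrary: p rule: less_induct)
  case less
  consider "p = 0" | "primitive_idempotent p"
    | a b where "idempotent a" "a \<noteq> 0" "idempotent b" "b \<noteq> 0" "p = a + b"
    using less.prems by (auto simp: primitive_idempotent_def)
  then show ?case
  proof cases
    case 1
    then show ?thesis
      by (intro exI[of _ "{}"]) (simp add: orthogonal_frame_def)
  next
    case 2
    then show ?thesis
      using primitive_idempotentD[OF 2]
      by (intro exI[of _ "{p}"]) (simp add: orthogonal_frame_def)
  next
    case (3 a b)
    have part: "\<exists>F. orthogonal_frame F \<and> \<Sum>F = a \<and> (\<forall>c\<in>F. a \<circ>\<^sub>J c = c \<and> b \<circ>\<^sub>J c = 0 \<and> p \<circ>\<^sub>J c = c)"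
      if ab: "idempotent a" "idempotent b" "b \<noteq> 0" "p = a + b" for a b
    proof -
      have "a \<circ>\<^sub>J b = 0"
        using idempotent_sum_orthogonal[of a b] less.prems ab by simp
      then have b0: "b \<circ>\<^sub>J y = 0" if "a \<circ>\<^sub>J y = y" for y
        using peirce_one_zero_orthogonal[OF ab(1) that] by (simp add: jprod_commute)
      have "p \<circ>\<^sub>J b = b"
        using \<open>a \<circ>\<^sub>J b = 0\<close> ab by (simp add: idempotent_def jprod_add_left)
      moreover have "a \<circ>\<^sub>J b \<noteq> b"
        using \<open>a \<circ>\<^sub>J b = 0\<close> ab(3) by simp
      ultimately have "{y. a \<circ>\<^sub>J y = y} \<subset> {y. p \<circ>\<^sub>J y = y}"
        using b0 ab(4) by (auto simp: jprod_add_left)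
      then have "dim {y. a \<circ>\<^sub>J y = y} < dim {y. p \<circ>\<^sub>J y = y}"
        using dim_psubset[of "{y. a \<circ>\<^sub>J y = y}" "{y. p \<circ>\<^sub>J y = y}"]
        by (simp add: span_eq_iff[THEN iffD2, OF subspace_peirce_one])
      from less.hyps[OF this ab(1)] show ?thesis
        using b0 ab(4) by (auto simp: jprod_add_left)
    qed
    obtain F where F: "orthogonal_frame F" "\<Sum>F = a"
      "\<And>c. c \<in> F \<Longrightarrow> a \<circ>\<^sub>J c = c \<and> b \<circ>\<^sub>J c = 0 \<and> p \<circ>\<^sub>J c = c"
      using part[of a b] 3 by blast
    obtain G where G: "orthogonal_frame G" "\<Sum>G = b"
      "\<And>c. c \<in> G \<Longrightarrow> b \<circ>\<^sub>J c = c \<and> a \<circ>\<^sub>J c = 0 \<and> p \<circ>\<^sub>J c = c"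
      using part[of b a] 3 by (auto simp: add.commute)
    have "c \<circ>\<^sub>J d = 0" if "c \<in> F" "d \<in> G" for c d
      using peirce_one_zero_orthogonal[of a c d] 3 F(3) G(3) that by blast
    note FG = orthogonal_frame_Un[OF F(1) G(1) this]
    have "\<Sum>(F \<union> G) = p"
      using F G FG(2) 3 by (subst sum.union_disjoint) (auto simp: orthogonal_frame_def)
    then show ?thesis
      using FG F(3) G(3) by (intro exI[of _ "F \<union> G"]) blast
  qed
qed

lemma orthogonal_sum_pointwise:
  assumes "finite F" "\<And>c. c \<in> F \<Longrightarrow> f c \<circ>\<^sub>J f c = f c"
    and "\<And>c d. c \<in> F \<Longrightarrow> d \<in> F \<Longrightarrow> c \<noteq> d \<Longrightarrow> f c \<circ>\<^sub>J f d = 0"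
  shows "(\<Sum>c\<in>F. l c *\<^sub>R f c) \<circ>\<^sub>J (\<Sum>c\<in>F. m c *\<^sub>R f c) = (\<Sum>c\<in>F. (l c * m c) *\<^sub>R f c)"
proof -
  have "(\<Sum>c\<in>F. l c *\<^sub>R f c) \<circ>\<^sub>J (\<Sum>c\<in>F. m c *\<^sub>R f c)
      = (\<Sum>c\<in>F. \<Sum>d\<in>F. (m d * l c) *\<^sub>R (f c \<circ>\<^sub>J f d))"
    by (simp add: jprod_sum_left jprod_sum_right jprod_scaleR_left jprod_scaleR_right
        scaleR_sum_right mult.commute) (rule sum.swap)
  also have "\<dots> = (\<Sum>c\<in>F. \<Sum>d\<in>F. if d = c then (l c * m c) *\<^sub>R f c else 0)"
    by (intro sum.cong refl) (auto simp: assms(2,3) mult.commute)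
  finally show ?thesis
    using assms(1) by simp
qed

lemma frame_jprod_left:
  assumes "orthogonal_frame F" "d \<in> F"
  shows "d \<circ>\<^sub>J (\<Sum>c\<in>F. l c *\<^sub>R c) = l d *\<^sub>R d"
proof -
  have "d \<circ>\<^sub>J (\<Sum>c\<in>F. l c *\<^sub>R c) = (\<Sum>c\<in>F. if c = d then l d *\<^sub>R d else 0)"
    unfolding jprod_sum_right using assms
    by (intro sum.cong) (auto simp: orthogonal_frame_def jprod_scaleR_right
        primitive_idempotentD(3))
  then show ?thesis
    using assms by (simp add: orthogonal_frame_def)
qed

text \<open>Each spectral idempotent is split into primitives. Those from different idempotents are
  orthogonal, so every primitive belongs to exactly one s, which is its eigenvalue.\<close>

lemma spectral_frame:
  fixes x :: "'a::euclidean_jordan_algebra"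
  obtains F l where "orthogonal_frame F" "\<Sum>F = junit" "x = (\<Sum>c\<in>F. l c *\<^sub>R c)"
proof -
  obtain S and e :: "real \<Rightarrow> 'a" where S: "finite S" "\<And>s. s \<in> S \<Longrightarrow> idempotent (e s)"
    "\<And>s t. s \<in> S \<Longrightarrow> t \<in> S \<Longrightarrow> s \<noteq> t \<Longrightarrow> e s \<circ>\<^sub>J e t = 0"
    "(\<Sum>s\<in>S. e s) = junit" and x: "x = (\<Sum>s\<in>S. s *\<^sub>R e s)"
    using spectral_idempotents[of x] by blast
  have "\<exists>F. orthogonal_frame F \<and> \<Sum>F = e s \<and> (\<forall>c\<in>F. e s \<circ>\<^sub>J c = c)" if "s \<in> S" for s
    using idempotent_frame[OF S(2)[OF that]] .
  then obtain F where F: "\<And>s. s \<in> S \<Longrightarrow> orthogonal_frame (F s)" "\<And>s. s \<in> S \<Longrightarrow> \<Sum>(F s) = e s"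
    "\<And>s c. s \<in> S \<Longrightarrow> c \<in> F s \<Longrightarrow> e s \<circ>\<^sub>J c = c"
    by metis
  have orth: "c \<circ>\<^sub>J d = 0" if st: "s \<in> S" "t \<in> S" "s \<noteq> t" and c: "c \<in> F s" and d: "d \<in> F t" for s t c d
  proof -
    have "e t \<circ>\<^sub>J e s = 0"
      using S(3) st by simp
    then have "d \<circ>\<^sub>J e s = 0"
      using peirce_one_zero_orthogonal[OF S(2) F(3)] st d by blast
    then show ?thesis
      using peirce_one_zero_orthogonal[OF S(2) F(3), of s c d] st c
      by (simp add: jprod_commute)
  qed
  have disj: "F s \<inter> F t = {}" if "s \<in> S" "t \<in> S" "s \<noteq> t" for s t
    using orthogonal_frame_Un(2)[OF F(1) F(1)] orth that by blast
  have fin: "finite (F s)" if "s \<in> S" for s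
    using F(1)[OF that] by (simp add: orthogonal_frame_def)
  define l where "l c = (THE s. s \<in> S \<and> c \<in> F s)" for c
  have l: "l c = s" if "s \<in> S" "c \<in> F s" for s c
    unfolding l_def using that disj by (intro the_equality) auto
  show thesis
  proof (rule that)
    show "orthogonal_frame (\<Union>s\<in>S. F s)"
      unfolding orthogonal_frame_def
    proof (intro conjI ballI impI)
      show "finite (\<Union>s\<in>S. F s)"
        using S(1) fin by blast
      show "primitive_idempotent c" if "c \<in> (\<Union>s\<in>S. F s)" for c
        using that F(1) by (auto simp: orthogonal_frame_def)
      show "c \<circ>\<^sub>J d = 0" if cd: "c \<in> (\<Union>s\<in>S. F s)" "d \<in> (\<Union>s\<in>S. F s)" "c \<noteq> d" for c d
      proof -
        obtain s t where st: "s \<in> S" "t \<in> S" "c \<in> F s" "d \<in> F t"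
          using cd by blast
        show ?thesis
          using orth[of s t c d] F(1)[of s] st cd(3)
          by (cases "s = t") (auto simp: orthogonal_frame_def)
      qed
    qed
    show "\<Sum>(\<Union>s\<in>S. F s) = junit"
      using sum.UNION_disjoint[OF S(1), of F "\<lambda>c. c"] fin disj F(2) S(4) by simp
    have "(\<Sum>c\<in>(\<Union>s\<in>S. F s). l c *\<^sub>R c) = (\<Sum>s\<in>S. \<Sum>c\<in>F s. l c *\<^sub>R c)"
      using S(1) fin disj by (intro sum.UNION_disjoint) auto
    also have "\<dots> = (\<Sum>s\<in>S. s *\<^sub>R \<Sum>(F s))"
      unfolding scaleR_sum_right by (intro sum.cong refl) (simp add: l)
    also have "\<dots> = x"
      by (simp add: x F(2))
    finally show "x = (\<Sum>c\<in>(\<Union>s\<in>S. F s). l c *\<^sub>R c)" ..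
  qed
qed

text \<open>The rescaling of B is carried by one element w. For primitive d, the frame members with
  a non-zero product with d have the length of d, so w acts on d as division by B(d,d), whichever
  frame defined w. Associativity need only be tested on primitive outer factors, since these
  span.\<close>

lemma (in assoc_form) trace_from_form:
  "\<exists>T :: 'a \<Rightarrow> real. linear T \<and> (\<forall>c. primitive_idempotent c \<longrightarrow> T c = 1) \<and>
     (\<forall>x y z. T ((x \<circ>\<^sub>J y) \<circ>\<^sub>J z) = T (x \<circ>\<^sub>J (y \<circ>\<^sub>J z)))"
proof -
  obtain F :: "'a set" where F: "orthogonal_frame F" "\<Sum>F = junit"
    using spectral_frame[of "0 :: 'a"] by metis
  define w where "w = (\<Sum>c\<in>F. (1 / B c c) *\<^sub>R c)"
  have w: "w \<circ>\<^sub>J d = (1 / B d d) *\<^sub>R d" if d: "primitive_idempotent d" for d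
  proof -
    have "(1 / B c c) *\<^sub>R (c \<circ>\<^sub>J d) = (1 / B d d) *\<^sub>R (c \<circ>\<^sub>J d)" if "c \<in> F" for c
      using primitive_same_length[of c d] d F(1) that
      by (cases "c \<circ>\<^sub>J d = 0") (auto simp: orthogonal_frame_def)
    then have "(\<Sum>c\<in>F. (1 / B c c) *\<^sub>R (c \<circ>\<^sub>J d)) = (\<Sum>c\<in>F. (1 / B d d) *\<^sub>R (c \<circ>\<^sub>J d))"
      by (rule sum.cong[OF refl])
    then have "w \<circ>\<^sub>J d = (1 / B d d) *\<^sub>R (\<Sum>F \<circ>\<^sub>J d)"
      by (simp only: w_def jprod_sum_left jprod_scaleR_left scaleR_sum_right)
    then show ?thesis
      by (simp only: F(2) jprod_unit_left)
  qed
  have T: "B w ((c \<circ>\<^sub>J y) \<circ>\<^sub>J d) = B w (c \<circ>\<^sub>J (y \<circ>\<^sub>J d))"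
    if c: "primitive_idempotent c" and d: "primitive_idempotent d" for c d y
  proof -
    have "B w ((c \<circ>\<^sub>J y) \<circ>\<^sub>J d) = B (w \<circ>\<^sub>J d) (c \<circ>\<^sub>J y)"
      by (simp only: form_assoc jprod_commute[of "c \<circ>\<^sub>J y" d])
    also have "\<dots> = (1 / B d d) * B (c \<circ>\<^sub>J d) y"
      by (simp add: w[OF d] form_scaleR_left form_move)
    also have "\<dots> = (1 / B c c) * B (c \<circ>\<^sub>J d) y"
      using primitive_same_length[OF c d] by (cases "c \<circ>\<^sub>J d = 0") simp_all
    also have "\<dots> = B (w \<circ>\<^sub>J c) (d \<circ>\<^sub>J y)"
      by (simp add: w[OF c] form_scaleR_left form_assoc)
    also have "\<dots> = B w (c \<circ>\<^sub>J (y \<circ>\<^sub>J d))"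
      by (simp only: form_assoc jprod_commute[of d y])
    finally show ?thesis .
  qed
  show ?thesis
  proof (intro exI[of _ "B w"] conjI allI impI)
    show "linear (B w)"
      by (rule linear_form_right)
    show "B w c = 1" if "primitive_idempotent c" for c
    proof -
      note c = primitive_idempotentD[OF that]
      have "B w c = B (w \<circ>\<^sub>J c) c"
        by (simp add: form_assoc c)
      then show ?thesis
        using form_pos[OF c(2)] by (simp add: w[OF that] form_scaleR_left)
    qed
    show "B w ((x \<circ>\<^sub>J y) \<circ>\<^sub>J z) = B w (x \<circ>\<^sub>J (y \<circ>\<^sub>J z))" for x y z
    proof -
      obtain G l where x: "orthogonal_frame G" "x = (\<Sum>c\<in>G. l c *\<^sub>R c)"
        using spectral_frame[of x] by metis
      obtain H m where z: "orthogonal_frame H" "z = (\<Sum>c\<in>H. m c *\<^sub>R c)"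
        using spectral_frame[of z] by metis
      show ?thesis
        unfolding x z using T x(1) z(1)
        by (simp add: jprod_sum_left jprod_sum_right form_sum_right jprod_scaleR_left
            jprod_scaleR_right form_scaleR_right orthogonal_frame_def)
    qed
  qed
qed

lemma frame_jpoly:
  assumes "orthogonal_frame F" "\<Sum>F = junit" "x = (\<Sum>c\<in>F. l c *\<^sub>R c)"
  shows "jpoly x p = (\<Sum>c\<in>F. poly p (l c) *\<^sub>R c)"
proof (induction p)
  case (pCons a p)
  have "x \<circ>\<^sub>J jpoly x p = (\<Sum>c\<in>F. (l c * poly p (l c)) *\<^sub>R c)"
    unfolding pCons.IH unfolding assms(3) using assms(1)
    by (intro orthogonal_sum_pointwise[where f = "\<lambda>c. c"])
      (auto simp: orthogonal_frame_def primitive_idempotentD)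
  then show ?case
    by (simp add: jpoly_pCons assms(2)[symmetric] scaleR_sum_right scaleR_add_left sum.distrib)
qed simp

lemma jpoly_eq_sum: "jpoly x (\<Sum>i\<le>k. monom (u i) i) = (\<Sum>i\<le>k. u i *\<^sub>R jpow x i)"
proof -
  have c: "coeff (\<Sum>i\<le>k. monom (u i) i) j = (if j \<le> k then u j else 0)" for j
    by (simp add: coeff_sum)
  have "degree (\<Sum>i\<le>k. monom (u i) i) \<le> k"
    using c by (intro degree_le) auto
  then show ?thesis
    by (simp add: jpoly_bound c)
qed

text \<open>The functional T counts the members of any complete frame, so all of these have the same
  size. Every element is annihilated in this degree, and one with distinct eigenvalues in no smaller
  one.\<close>

lemma jrank_eq_card:
  fixes F :: "'a::euclidean_jordan_algebra set"
  assumes "orthogonal_frame F" "\<Sum>F = junit"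
  shows "jrank TYPE('a) = card F"
proof -
  obtain B :: "'a \<Rightarrow> 'a \<Rightarrow> real" where "assoc_form B"
    using assoc_form_exists by blast
  then interpret assoc_form B .
  obtain T :: "'a \<Rightarrow> real" where T: "linear T" "\<And>c. primitive_idempotent c \<Longrightarrow> T c = 1"
    using trace_from_form by blast
  have card: "T junit = card G" if "orthogonal_frame G" "\<Sum>G = junit" for G :: "'a set"
  proof -
    have "T junit = (\<Sum>c\<in>G. T c)"
      using linear_sum[OF T(1), of "\<lambda>c. c" G] that(2) by simp
    also have "\<dots> = card G"
      using that(1) T(2) by (simp add: orthogonal_frame_def)
    finally show ?thesis .
  qed
  show ?thesis
    unfolding jrank_def
  proof (rule Least_equality)
    show "\<forall>x::'a. \<exists>u::nat \<Rightarrow> real. (\<exists>i\<le>card F. u i \<noteq> 0) \<and> (\<Sum>i\<le>card F. u i *\<^sub>R jpow x i) = 0"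
    proof
      fix x :: 'a
      obtain G l where x: "orthogonal_frame G" "\<Sum>G = junit" "x = (\<Sum>c\<in>G. l c *\<^sub>R c)"
        using spectral_frame[of x] by metis
      have "card G = card F"
        using card[OF x(1,2)] card[OF assms] by simp
      \<comment> \<open>The characteristic polynomial; being monic, it gives a non-trivial
        relation.\<close>
      define p where "p = (\<Prod>c\<in>G. [:- l c, 1:])"
      have fin: "finite G"
        using x(1) by (simp add: orthogonal_frame_def)
      have deg: "degree p = card F"
        unfolding p_def \<open>card G = card F\<close>[symmetric] by (subst degree_prod_eq_sum_degree) auto
      have "lead_coeff p = 1"
        unfolding p_def by (simp add: lead_coeff_prod)
      then have "coeff p (card F) \<noteq> 0"
        by (simp add: deg)
      moreover have "poly p (l c) = 0" if "c \<in> G" for c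
        unfolding p_def poly_prod using fin that by auto
      then have "jpoly x p = 0"
        by (simp add: frame_jpoly[OF x])
      then have "(\<Sum>i\<le>card F. coeff p i *\<^sub>R jpow x i) = 0"
        by (simp add: jpoly_def deg)
      ultimately show "\<exists>u::nat \<Rightarrow> real. (\<exists>i\<le>card F. u i \<noteq> 0) \<and> (\<Sum>i\<le>card F. u i *\<^sub>R jpow x i) = 0"
        by blast
    qed
  next
    fix k
    assume k: "\<forall>x::'a. \<exists>u::nat \<Rightarrow> real. (\<exists>i\<le>k. u i \<noteq> 0) \<and> (\<Sum>i\<le>k. u i *\<^sub>R jpow x i) = 0"
    show "card F \<le> k"
    proof (rule ccontr)
      assume "\<not> card F \<le> k"
      have fin: "finite F"
        using assms(1) by (simp add: orthogonal_frame_def)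
      then obtain f :: "'a \<Rightarrow> nat" where f: "inj_on f F"
        using finite_imp_inj_to_nat_seg by metis
      \<comment> \<open>An injection into the naturals supplies distinct eigenvalues.\<close>
      define x where "x = (\<Sum>c\<in>F. real (f c) *\<^sub>R c)"
      obtain u i where u: "i \<le> k" "u i \<noteq> 0" "(\<Sum>i\<le>k. u i *\<^sub>R jpow x i) = 0"
        using k by blast
      define p where "p = (\<Sum>i\<le>k. monom (u i) i)"
      have c: "coeff p j = (if j \<le> k then u j else 0)" for j
        by (simp add: p_def coeff_sum)
      have "(\<Sum>c\<in>F. poly p (real (f c)) *\<^sub>R c) = 0"
        using frame_jpoly[OF assms x_def, of p] u(3) by (simp add: p_def jpoly_eq_sum)
      then have "poly p (real (f d)) *\<^sub>R d = 0" if "d \<in> F" for d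
        using frame_jprod_left[OF assms(1) that, of "\<lambda>c. poly p (real (f c))"] by simp
      then have root: "poly p (real (f d)) = 0" if "d \<in> F" for d
        using that assms(1) primitive_idempotentD(2)[of d] by (auto simp: orthogonal_frame_def)
      have "card ((\<lambda>d. real (f d)) ` F) = card F"
        using f by (intro card_image) (auto simp: inj_on_def)
      moreover have "degree p \<le> k"
        using c by (intro degree_le) auto
      ultimately have "p = 0"
        using root \<open>\<not> card F \<le> k\<close>
        by (intro poly_eqI_degree[of "(\<lambda>d. real (f d)) ` F"]) auto
      then show False
        using c[of i] u by simp
    qed
  qed
qed

section \<open>Eigenvalues, trace and rank\<close>

lemma spectral_decomposition_exists:
  fixes x :: "'a::euclidean_jordan_algebra"
  shows "\<exists>l c. spectral_decomposition x l c"
proof -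
  obtain F m where F: "orthogonal_frame F" "\<Sum>F = junit" "x = (\<Sum>c\<in>F. m c *\<^sub>R c)"
    using spectral_frame[of x] by metis
  then obtain c where "bij_betw c {..<jrank TYPE('a)} F"
    using jrank_eq_card[OF F(1,2)] ex_bij_betw_nat_finite[of F]
    by (auto simp: orthogonal_frame_def atLeast0LessThan)
  then have c: "inj_on c {..<jrank TYPE('a)}" "c ` {..<jrank TYPE('a)} = F"
    by (auto simp: bij_betw_def)
  have sum: "(\<Sum>d\<in>F. g d) = (\<Sum>i<jrank TYPE('a). g (c i))" for g :: "'a \<Rightarrow> 'a"
    using sum.reindex[OF c(1), of g] by (simp add: c(2))
  have "c i \<in> F" if "i < jrank TYPE('a)" for i
    using c(2) that by blast
  moreover have "c i \<noteq> c j" if "i < jrank TYPE('a)" "j < jrank TYPE('a)" "i \<noteq> j" for i j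
    using c(1) that by (auto simp: inj_on_def)
  ultimately have "jordan_frame c"
    using F(1,2) sum[of "\<lambda>d. d"] by (auto simp: jordan_frame_def orthogonal_frame_def)
  moreover have "x = (\<Sum>i<jrank TYPE('a). m (c i) *\<^sub>R c i)"
    using F(3) sum[of "\<lambda>d. m d *\<^sub>R d"] by simp
  ultimately show ?thesis
    unfolding spectral_decomposition_def by (intro exI[of _ "\<lambda>i. m (c i)"] exI[of _ c]) simp
qed

lemma spectral_decomposition_eigval: "\<exists>c. spectral_decomposition x (eigval x) c"
  unfolding eigval_def
  by (rule someI_ex[where P = "\<lambda>l. \<exists>c. spectral_decomposition x l c"])
    (rule spectral_decomposition_exists)

text \<open>On any spectral decomposition the linear functional T equals the sum of the eigenvalues.
  So \<open>jtrace\<close> is T, whatever \<open>eigval\<close> has chosen, and inherits its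
  properties.\<close>

lemma jtrace_properties:
  shows linear_jtrace: "linear (jtrace :: 'a::euclidean_jordan_algebra \<Rightarrow> real)"
    and jtrace_primitive: "\<And>c :: 'a. primitive_idempotent c \<Longrightarrow> jtrace c = 1"
    and jtrace_assoc: "\<And>x y z :: 'a. jtrace ((x \<circ>\<^sub>J y) \<circ>\<^sub>J z) = jtrace (x \<circ>\<^sub>J (y \<circ>\<^sub>J z))"
proof -
  obtain B :: "'a \<Rightarrow> 'a \<Rightarrow> real" where "assoc_form B"
    using assoc_form_exists by blast
  then interpret assoc_form B .
  obtain T :: "'a \<Rightarrow> real" where T: "linear T" "\<And>c. primitive_idempotent c \<Longrightarrow> T c = 1"
    "\<And>x y z. T ((x \<circ>\<^sub>J y) \<circ>\<^sub>J z) = T (x \<circ>\<^sub>J (y \<circ>\<^sub>J z))"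
    using trace_from_form by blast
  have "jtrace x = T x" for x
  proof -
    obtain c where "spectral_decomposition x (eigval x) c"
      using spectral_decomposition_eigval by blast
    then have c: "jordan_frame c" "x = (\<Sum>i<jrank TYPE('a). eigval x i *\<^sub>R c i)"
      by (auto simp: spectral_decomposition_def)
    have "T x = (\<Sum>i<jrank TYPE('a). eigval x i * T (c i))"
      by (subst c(2)) (simp add: linear_sum[OF T(1)] linear_scale[OF T(1)])
    also have "\<dots> = jtrace x"
      using c(1) T(2) by (simp add: jtrace_def jordan_frame_def)
    finally show ?thesis ..
  qed
  then have "jtrace = T" ..
  then show "linear (jtrace :: 'a \<Rightarrow> real)"
    "\<And>c :: 'a. primitive_idempotent c \<Longrightarrow> jtrace c = 1"
    "\<And>x y z :: 'a. jtrace ((x \<circ>\<^sub>J y) \<circ>\<^sub>J z) = jtrace (x \<circ>\<^sub>J (y \<circ>\<^sub>J z))"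
    using T by auto
qed

lemma jtrace_unit: "jtrace (junit :: 'a::euclidean_jordan_algebra) = real (jrank TYPE('a))"
proof -
  obtain l and c :: "nat \<Rightarrow> 'a" where "spectral_decomposition junit l c"
    using spectral_decomposition_exists by blast
  then have c: "jordan_frame c"
    by (simp add: spectral_decomposition_def)
  then have "jtrace (junit :: 'a) = (\<Sum>i<jrank TYPE('a). jtrace (c i))"
    by (simp add: jordan_frame_def flip: linear_sum[OF linear_jtrace])
  then show ?thesis
    using c by (simp add: jordan_frame_def jtrace_primitive)
qed

lemma junit_nonzero: "(junit :: 'a::euclidean_jordan_algebra) \<noteq> 0"
proof
  assume "(junit :: 'a) = 0"
  then have "x = 0" for x :: 'a
    by (metis jprod_unit jprod_zero(2))
  then show False
    using nonzero_Basis nonempty_Basis by blast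
qed

lemma jrank_pos: "jrank TYPE('a::euclidean_jordan_algebra) > 0"
proof -
  obtain l and c :: "nat \<Rightarrow> 'a" where "spectral_decomposition junit l c"
    using spectral_decomposition_exists by blast
  then show ?thesis
    using junit_nonzero[where 'a='a] by (auto simp: spectral_decomposition_def intro: gr0I)
qed

subsection \<open>The trace form and the symmetric cone\<close>

lemma jordan_frame_orthonormal:
  fixes c :: "nat \<Rightarrow> 'a::euclidean_jordan_algebra"
  assumes "jordan_frame c" "i < jrank TYPE('a)" "j < jrank TYPE('a)"
  shows "c i \<circ>\<^sub>J c j = (if i = j then c i else 0)"
  using assms primitive_idempotentD(3) by (auto simp: jordan_frame_def)

lemma spectral_jprod:
  fixes c :: "nat \<Rightarrow> 'a::euclidean_jordan_algebra"
  assumes "spectral_decomposition x l c" "spectral_decomposition y m c"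
  shows "x \<circ>\<^sub>J y = (\<Sum>i<jrank TYPE('a). (l i * m i) *\<^sub>R c i)"
proof -
  have c: "jordan_frame c" "x = (\<Sum>i<jrank TYPE('a). l i *\<^sub>R c i)"
    "y = (\<Sum>i<jrank TYPE('a). m i *\<^sub>R c i)"
    using assms by (auto simp: spectral_decomposition_def)
  show ?thesis
    unfolding c(2,3) by (rule orthogonal_sum_pointwise) (auto simp: jordan_frame_orthonormal[OF c(1)])
qed

lemma spectral_jtrace:
  fixes c :: "nat \<Rightarrow> 'a::euclidean_jordan_algebra"
  assumes "jordan_frame c"
  shows "jtrace (\<Sum>i<jrank TYPE('a). l i *\<^sub>R c i) = (\<Sum>i<jrank TYPE('a). l i)"
  using assms
  by (simp add: linear_sum[OF linear_jtrace] linear_scale[OF linear_jtrace] jordan_frame_def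
      jtrace_primitive)

interpretation trace: assoc_form "trace_inner :: 'a::euclidean_jordan_algebra \<Rightarrow> 'a \<Rightarrow> real"
proof
  show "trace_inner (x + y) z = trace_inner x z + trace_inner y z"
    "trace_inner x (y + z) = trace_inner x y + trace_inner x z"
    "trace_inner (s *\<^sub>R x) y = s * trace_inner x y"
    "trace_inner x (s *\<^sub>R y) = s * trace_inner x y" for x y z :: 'a and s
    by (simp_all add: trace_inner_def jprod_simps linear_add[OF linear_jtrace]
        linear_scale[OF linear_jtrace])
  show "trace_inner (x \<circ>\<^sub>J y) z = trace_inner x (y \<circ>\<^sub>J z)" for x y z :: 'a
    by (simp add: trace_inner_def jtrace_assoc)
  show "trace_inner x x > 0" if "x \<noteq> 0" for x :: 'a
  proof -
    obtain l c where x: "spectral_decomposition x l c"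
      using spectral_decomposition_exists by blast
    then have c: "jordan_frame c" "x = (\<Sum>i<jrank TYPE('a). l i *\<^sub>R c i)"
      by (auto simp: spectral_decomposition_def)
    have "trace_inner x x = (\<Sum>i<jrank TYPE('a). (l i)\<^sup>2)"
      by (simp add: trace_inner_def spectral_jprod[OF x x] spectral_jtrace[OF c(1)] power2_eq_square)
    moreover have "\<exists>i<jrank TYPE('a). l i \<noteq> 0"
      using that c(2) by (intro ccontr[of "\<exists>i<_. _ i"]) simp
    then obtain i where "i < jrank TYPE('a)" "l i \<noteq> 0"
      by blast
    ultimately show ?thesis
      by (auto intro!: sum_pos2[of _ i])
  qed
qed

lemma trace_inner_junit [simp]: "trace_inner x junit = jtrace x" "trace_inner junit x = jtrace x"
  by (simp_all add: trace_inner_def)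

lemma trace_inner_primitive: "primitive_idempotent c \<Longrightarrow> trace_inner c c = 1"
  by (simp add: trace_inner_def primitive_idempotentD(3) jtrace_primitive)

lemma spectral_trace_inner:
  fixes c :: "nat \<Rightarrow> 'a::euclidean_jordan_algebra"
  assumes "spectral_decomposition x l c" "spectral_decomposition y m c"
  shows "trace_inner x y = (\<Sum>i<jrank TYPE('a). l i * m i)"
  unfolding trace_inner_def spectral_jprod[OF assms]
  using assms by (intro spectral_jtrace) (simp add: spectral_decomposition_def)

lemma spectral_jprod_frame:
  fixes c :: "nat \<Rightarrow> 'a::euclidean_jordan_algebra"
  assumes "spectral_decomposition x l c" "j < jrank TYPE('a)"
  shows "x \<circ>\<^sub>J c j = l j *\<^sub>R c j"
proof -
  have "spectral_decomposition (c j) (\<lambda>i. if i = j then 1 else 0) c"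
    using assms by (simp add: spectral_decomposition_def if_distrib[of "\<lambda>s. s *\<^sub>R _"] cong: if_cong)
  from spectral_jprod[OF assms(1) this] show ?thesis
    using assms(2) by (simp add: if_distrib[of "\<lambda>s. _ * s"] if_distrib[of "\<lambda>s. s *\<^sub>R _"] cong: if_cong)
qed

lemma spectral_trace_frame:
  fixes c :: "nat \<Rightarrow> 'a::euclidean_jordan_algebra"
  assumes "spectral_decomposition x l c" "j < jrank TYPE('a)"
  shows "trace_inner x (c j) = l j"
  using spectral_jprod_frame[OF assms] assms
  by (simp add: trace_inner_def linear_scale[OF linear_jtrace] jtrace_primitive
      spectral_decomposition_def jordan_frame_def)

lemma spectral_decomposition_junit:
  "jordan_frame c \<Longrightarrow> spectral_decomposition junit (\<lambda>_. 1) c"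
  by (simp add: spectral_decomposition_def jordan_frame_def)

lemma spectral_decomposition_affine:
  fixes c :: "nat \<Rightarrow> 'a::euclidean_jordan_algebra"
  assumes "spectral_decomposition x l c"
  shows "spectral_decomposition (s *\<^sub>R x + t *\<^sub>R junit) (\<lambda>i. s * l i + t) c"
proof -
  have "jordan_frame c" "x = (\<Sum>i<jrank TYPE('a). l i *\<^sub>R c i)" "(\<Sum>i<jrank TYPE('a). c i) = junit"
    using assms by (auto simp: spectral_decomposition_def jordan_frame_def)
  then show ?thesis
    by (simp add: spectral_decomposition_def scaleR_add_left sum.distrib scaleR_sum_right[of s]
        flip: scaleR_sum_right[of t])
qed

text \<open>A row or column sum is the trace of a primitive. These weights turn sums over the
  eigenvalues of two elements into double sums that can be compared term by term.\<close>

lemma frames_doubly_stochastic: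
  fixes c d :: "nat \<Rightarrow> 'a::euclidean_jordan_algebra"
  assumes "jordan_frame c" "jordan_frame d"
  shows "\<And>i j. i < jrank TYPE('a) \<Longrightarrow> j < jrank TYPE('a) \<Longrightarrow> trace_inner (c i) (d j) \<ge> 0"
    and "\<And>i. i < jrank TYPE('a) \<Longrightarrow> (\<Sum>j<jrank TYPE('a). trace_inner (c i) (d j)) = 1"
    and "\<And>j. j < jrank TYPE('a) \<Longrightarrow> (\<Sum>i<jrank TYPE('a). trace_inner (c i) (d j)) = 1"
proof -
  have c: "\<And>i. i < jrank TYPE('a) \<Longrightarrow> primitive_idempotent (c i)" "(\<Sum>i<jrank TYPE('a). c i) = junit"
    and d: "\<And>i. i < jrank TYPE('a) \<Longrightarrow> primitive_idempotent (d i)" "(\<Sum>i<jrank TYPE('a). d i) = junit"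
    using assms by (auto simp: jordan_frame_def)
  show "trace_inner (c i) (d j) \<ge> 0" if "i < jrank TYPE('a)" "j < jrank TYPE('a)" for i j
    using trace.form_idempotents(1) c d that primitive_idempotentD(1) by blast
  show "(\<Sum>j<jrank TYPE('a). trace_inner (c i) (d j)) = 1" if "i < jrank TYPE('a)" for i
    using c that by (simp add: d(2) jtrace_primitive flip: trace.form_sum_right)
  show "(\<Sum>i<jrank TYPE('a). trace_inner (c i) (d j)) = 1" if "j < jrank TYPE('a)" for j
    using d that by (simp add: c(2) jtrace_primitive flip: trace.form_sum_left)
qed

lemma frames_sum_weights:
  fixes c d :: "nat \<Rightarrow> 'a::euclidean_jordan_algebra"
  assumes "jordan_frame c" "jordan_frame d"
  shows "(\<Sum>i<jrank TYPE('a). g i) = (\<Sum>i<jrank TYPE('a). \<Sum>j<jrank TYPE('a). g i * trace_inner (c i) (d j))"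
    and "(\<Sum>j<jrank TYPE('a). g j) = (\<Sum>i<jrank TYPE('a). \<Sum>j<jrank TYPE('a). g j * trace_inner (c i) (d j))"
proof -
  show "(\<Sum>i<jrank TYPE('a). g i) = (\<Sum>i<jrank TYPE('a). \<Sum>j<jrank TYPE('a). g i * trace_inner (c i) (d j))"
    using frames_doubly_stochastic(2)[OF assms] by (simp flip: sum_distrib_left)
  show "(\<Sum>j<jrank TYPE('a). g j) = (\<Sum>i<jrank TYPE('a). \<Sum>j<jrank TYPE('a). g j * trace_inner (c i) (d j))"
    by (subst sum.swap) (use frames_doubly_stochastic(3)[OF assms] in \<open>simp flip: sum_distrib_left\<close>)
qed

lemma spectral_decompositions_match:
  fixes c d :: "nat \<Rightarrow> 'a::euclidean_jordan_algebra"
  assumes "spectral_decomposition x l c" "spectral_decomposition x m d"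
    and "i < jrank TYPE('a)" "j < jrank TYPE('a)" "trace_inner (c i) (d j) \<noteq> 0"
  shows "l i = m j"
proof -
  have "l i * trace_inner (c i) (d j) = trace_inner (x \<circ>\<^sub>J c i) (d j)"
    by (simp add: spectral_jprod_frame[OF assms(1,3)] trace.form_scaleR_left)
  also have "\<dots> = trace_inner (c i) (x \<circ>\<^sub>J d j)"
    by (rule trace.form_move)
  also have "\<dots> = m j * trace_inner (c i) (d j)"
    by (simp add: spectral_jprod_frame[OF assms(2,4)] trace.form_scaleR_right)
  finally show ?thesis
    using assms(5) by simp
qed

text \<open>Independence of the decomposition without a permutation of eigenvalues: weights between
  different eigenvalues vanish because multiplication by x is self-adjoint.\<close>

lemma spectral_sum_unique:
  fixes c d :: "nat \<Rightarrow> 'a::euclidean_jordan_algebra"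
  assumes "spectral_decomposition x l c" "spectral_decomposition x m d"
  shows "(\<Sum>i<jrank TYPE('a). g (l i) :: real) = (\<Sum>i<jrank TYPE('a). g (m i))"
proof -
  have cd: "jordan_frame c" "jordan_frame d"
    using assms by (auto simp: spectral_decomposition_def)
  have "g (l i) * trace_inner (c i) (d j) = g (m j) * trace_inner (c i) (d j)"
    if "i < jrank TYPE('a)" "j < jrank TYPE('a)" for i j
    using spectral_decompositions_match[OF assms that] by (cases "trace_inner (c i) (d j) = 0") auto
  then show ?thesis
    unfolding frames_sum_weights(1)[OF cd, of "\<lambda>i. g (l i)"]
      frames_sum_weights(2)[OF cd, of "\<lambda>j. g (m j)"]
    by (intro sum.cong) auto
qed

section \<open>The cone of squares and its interior\<close>

definition square_cone :: "'a::euclidean_jordan_algebra set" where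
  "square_cone = range (\<lambda>x. x \<circ>\<^sub>J x)"

text \<open>If x pairs nonnegatively with its own frame, its eigenvalues have square roots;
  conversely idempotents pair nonnegatively with each other. This exhibits the cone as an
  intersection of closed half-spaces.\<close>

lemma square_cone_iff:
  "x \<in> square_cone \<longleftrightarrow> (\<forall>p. primitive_idempotent p \<longrightarrow> trace_inner x p \<ge> 0)"
  (is "_ \<longleftrightarrow> ?R") for x :: "'a::euclidean_jordan_algebra"
proof
  assume "x \<in> square_cone"
  then obtain y where y: "x = y \<circ>\<^sub>J y"
    by (auto simp: square_cone_def)
  obtain l c where ylc: "spectral_decomposition y l c"
    using spectral_decomposition_exists by blast
  then have c: "jordan_frame c"
    by (simp add: spectral_decomposition_def)
  show ?R
  proof (intro allI impI)
    fix p :: 'a assume "primitive_idempotent p"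
    then have "trace_inner (c i) p \<ge> 0" if "i < jrank TYPE('a)" for i
      using trace.form_idempotents(1) c that primitive_idempotentD(1)
      by (auto simp: jordan_frame_def)
    then show "trace_inner x p \<ge> 0"
      by (auto simp: y spectral_jprod[OF ylc ylc] trace.form_sum_left trace.form_scaleR_left
          intro!: sum_nonneg mult_nonneg_nonneg[OF zero_le_square])
  qed
next
  assume R: ?R
  obtain l c where x: "spectral_decomposition x l c"
    using spectral_decomposition_exists by blast
  then have c: "jordan_frame c" "x = (\<Sum>i<jrank TYPE('a). l i *\<^sub>R c i)"
    by (auto simp: spectral_decomposition_def)
  have l: "l i \<ge> 0" if "i < jrank TYPE('a)" for i
    using R c(1) that spectral_trace_frame[OF x that] by (auto simp: jordan_frame_def)
  define y where "y = (\<Sum>i<jrank TYPE('a). sqrt (l i) *\<^sub>R c i)"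
  have y: "spectral_decomposition y (\<lambda>i. sqrt (l i)) c"
    using c by (simp add: y_def spectral_decomposition_def)
  have "y \<circ>\<^sub>J y = x"
    unfolding spectral_jprod[OF y y] c(2) by (intro sum.cong) (simp_all add: l)
  then show "x \<in> square_cone"
    unfolding square_cone_def by blast
qed

lemma square_cone_spectral:
  fixes c :: "nat \<Rightarrow> 'a::euclidean_jordan_algebra"
  assumes "spectral_decomposition x l c"
  shows "x \<in> square_cone \<longleftrightarrow> (\<forall>i<jrank TYPE('a). l i \<ge> 0)"
proof
  show "\<forall>i<jrank TYPE('a). l i \<ge> 0" if "x \<in> square_cone"
    using that spectral_trace_frame[OF assms] assms
    by (metis square_cone_iff spectral_decomposition_def jordan_frame_def)
  assume l: "\<forall>i<jrank TYPE('a). l i \<ge> 0"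
  have "trace_inner x p \<ge> 0" if "primitive_idempotent p" for p
  proof -
    have "trace_inner (c i) p \<ge> 0" if "i < jrank TYPE('a)" for i
      using trace.form_idempotents(1) assms \<open>primitive_idempotent p\<close> that primitive_idempotentD(1)
      by (auto simp: jordan_frame_def spectral_decomposition_def)
    then show ?thesis
      using assms l
      by (auto simp: spectral_decomposition_def trace.form_sum_left trace.form_scaleR_left
          intro!: sum_nonneg)
  qed
  then show "x \<in> square_cone"
    by (simp add: square_cone_iff)
qed

lemma square_cone_inner_nonneg:
  assumes "x \<in> square_cone" "y \<in> square_cone"
  shows "trace_inner x y \<ge> 0"
proof -
  obtain l c where y: "spectral_decomposition y l c"
    using spectral_decomposition_exists by blast
  then have "y = (\<Sum>i<jrank TYPE('a). l i *\<^sub>R c i)" "\<forall>i<jrank TYPE('a). primitive_idempotent (c i)"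
    by (auto simp: spectral_decomposition_def jordan_frame_def)
  then show ?thesis
    using assms y square_cone_spectral[OF y]
    by (auto simp: trace.form_sum_right trace.form_scaleR_right square_cone_iff[of x]
        intro!: sum_nonneg)
qed

lemma square_cone_add: "x \<in> square_cone \<Longrightarrow> y \<in> square_cone \<Longrightarrow> x + y \<in> square_cone"
  by (simp add: square_cone_iff trace.form_add_left)

lemma square_cone_scaleR: "x \<in> square_cone \<Longrightarrow> s \<ge> 0 \<Longrightarrow> s *\<^sub>R x \<in> square_cone"
  by (simp add: square_cone_iff trace.form_scaleR_left)

lemma idempotent_square_cone: "idempotent p \<Longrightarrow> p \<in> square_cone"
  unfolding square_cone_def idempotent_def by (rule range_eqI[of _ _ p]) simp

lemma continuous_on_trace_inner [continuous_intros]: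
  fixes f g :: "'b::topological_space \<Rightarrow> 'a::euclidean_jordan_algebra"
  assumes "continuous_on A f" "continuous_on A g"
  shows "continuous_on A (\<lambda>t. trace_inner (f t) (g t))"
proof -
  have "bilinear (trace_inner :: 'a \<Rightarrow> 'a \<Rightarrow> real)"
    unfolding bilinear_def using trace.linear_form_left trace.linear_form_right by blast
  then have "bounded_bilinear (trace_inner :: 'a \<Rightarrow> 'a \<Rightarrow> real)"
    by (simp add: bilinear_conv_bounded_bilinear)
  then show ?thesis
    using assms by (rule bounded_bilinear.continuous_on)
qed

lemma closed_square_cone: "closed (square_cone :: 'a::euclidean_jordan_algebra set)"
proof -
  have "square_cone = (\<Inter>p\<in>{p :: 'a. primitive_idempotent p}. {x. 0 \<le> trace_inner x p})"
    by (auto simp: square_cone_iff)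
  moreover have "closed (\<Inter>p\<in>{p :: 'a. primitive_idempotent p}. {x. 0 \<le> trace_inner x p})"
    by (intro closed_INT ballI closed_Collect_le continuous_intros)
  ultimately show ?thesis
    by simp
qed

text \<open>Describing the interior through \<open>junit\<close> removes the norm of the class from
  all later arguments and records a margin m.\<close>

lemma sym_cone_iff_shift:
  fixes x :: "'a::euclidean_jordan_algebra"
  shows "x \<in> sym_cone \<longleftrightarrow> (\<exists>m>0. x - m *\<^sub>R junit \<in> square_cone)"
proof
  assume "x \<in> sym_cone"
  then obtain e where e: "e > 0" "ball x e \<subseteq> square_cone"
    by (auto simp: sym_cone_def square_cone_def mem_interior)
  define m where "m = e / (2 * norm (junit :: 'a))"
  have "m > 0"
    using e junit_nonzero[where 'a='a] by (simp add: m_def)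
  have "x - m *\<^sub>R junit \<in> ball x e"
    using e junit_nonzero[where 'a='a] by (simp add: dist_norm m_def)
  then show "\<exists>m>0. x - m *\<^sub>R junit \<in> square_cone"
    using e \<open>m > 0\<close> by blast
next
  assume "\<exists>m>0. x - m *\<^sub>R junit \<in> square_cone"
  then obtain m where m: "m > 0" "x - m *\<^sub>R junit \<in> square_cone"
    by blast
  \<comment> \<open>A ball for the trace form: primitives have trace length 1, so within radius m
    the pairing with a primitive changes by less than m.\<close>
  define U where "U = {y. trace_inner (y - x) (y - x) < m\<^sup>2}"
  have "open U"
    unfolding U_def by (intro open_Collect_less continuous_intros)
  moreover have "x \<in> U"
    using m by (simp add: U_def)
  moreover have "U \<subseteq> square_cone"
  proof
    fix y assume "y \<in> U"
    show "y \<in> square_cone"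
      unfolding square_cone_iff
    proof (intro allI impI)
      fix p :: 'a assume p: "primitive_idempotent p"
      have "(trace_inner (y - x) p)\<^sup>2 \<le> trace_inner (y - x) (y - x)"
        using trace.form_Cauchy_Schwarz[of "y - x" p] by (simp add: trace_inner_primitive[OF p])
      also have "\<dots> < m\<^sup>2"
        using \<open>y \<in> U\<close> by (simp add: U_def)
      finally have "\<bar>trace_inner (y - x) p\<bar> < m"
        using m(1) by (metis power2_abs power2_less_imp_less less_imp_le)
      moreover have "trace_inner (x - m *\<^sub>R junit) p \<ge> 0"
        using m(2) p by (simp add: square_cone_iff)
      ultimately show "trace_inner y p \<ge> 0"
        using jtrace_primitive[OF p] by (simp add: trace.form_simps)
    qed
  qed
  ultimately show "x \<in> sym_cone"
    unfolding sym_cone_def square_cone_def[symmetric] by (rule interiorI)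
qed

lemma sym_cone_spectral:
  fixes c :: "nat \<Rightarrow> 'a::euclidean_jordan_algebra"
  assumes "spectral_decomposition x l c"
  shows "x \<in> sym_cone \<longleftrightarrow> (\<forall>i<jrank TYPE('a). l i > 0)"
proof -
  have "x - m *\<^sub>R junit \<in> square_cone \<longleftrightarrow> (\<forall>i<jrank TYPE('a). l i \<ge> m)" for m
    using square_cone_spectral[OF spectral_decomposition_affine[OF assms, of 1 "- m"]] by simp
  then have "x \<in> sym_cone \<longleftrightarrow> (\<exists>m>0. \<forall>i<jrank TYPE('a). l i \<ge> m)"
    by (simp add: sym_cone_iff_shift)
  also have "\<dots> \<longleftrightarrow> (\<forall>i<jrank TYPE('a). l i > 0)"
  proof
    assume pos: "\<forall>i<jrank TYPE('a). l i > 0"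
    have "Min (l ` {..<jrank TYPE('a)}) > 0"
      using pos jrank_pos[where 'a='a] by (subst Min_gr_iff) auto
    then show "\<exists>m>0. \<forall>i<jrank TYPE('a). l i \<ge> m"
      by (intro exI[of _ "Min (l ` {..<jrank TYPE('a)})"]) auto
  qed (auto intro: less_le_trans)
  finally show ?thesis .
qed

lemma junit_sym_cone: "junit \<in> sym_cone"
proof -
  obtain l c where "spectral_decomposition (junit :: 'a) l c"
    using spectral_decomposition_exists by blast
  then have "jordan_frame c"
    by (simp add: spectral_decomposition_def)
  then show ?thesis
    using sym_cone_spectral[OF spectral_decomposition_junit] by simp
qed

lemma sym_cone_subset: "sym_cone \<subseteq> square_cone"
  unfolding sym_cone_def square_cone_def by (rule interior_subset)

lemma closure_sym_cone: "closure sym_cone = (square_cone :: 'a::euclidean_jordan_algebra set)"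
proof -
  have "convex (square_cone :: 'a set)"
    by (intro convexI square_cone_add square_cone_scaleR)
  moreover have "interior square_cone \<noteq> ({} :: 'a set)"
    using junit_sym_cone unfolding sym_cone_def square_cone_def by blast
  ultimately show ?thesis
    using convex_closure_interior closed_square_cone
    unfolding sym_cone_def square_cone_def[symmetric] by (metis closure_closed)
qed

subsection \<open>Projections and the quadratic map\<close>

lemma frob_norm_nonneg: "frob_norm x \<ge> 0"
  and frob_norm_square: "(frob_norm x)\<^sup>2 = trace_inner x x"
  by (simp_all add: frob_norm_def trace.form_nonneg)

lemma trace_inner_le_frob_norm: "\<bar>trace_inner x y\<bar> \<le> frob_norm x * frob_norm y"
proof -
  have "\<bar>trace_inner x y\<bar>\<^sup>2 \<le> (frob_norm x * frob_norm y)\<^sup>2"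
    using trace.form_Cauchy_Schwarz[of x y] by (simp add: power_mult_distrib frob_norm_square)
  then show ?thesis
    by (rule power2_le_imp_le) (simp add: frob_norm_nonneg)
qed

lemma frob_norm_le_iff: "frob_norm x \<le> frob_norm y \<longleftrightarrow> trace_inner x x \<le> trace_inner y y"
  by (simp add: frob_norm_def)

text \<open>Moreau decomposition: v = p - n with p and n in the cone and orthogonal, so dropping n
  only increases the pairing with a cone element.\<close>

lemma cone_proj:
  fixes v :: "'a::euclidean_jordan_algebra"
  shows "y \<in> square_cone \<Longrightarrow> trace_inner v y \<le> trace_inner (cone_proj v) y"
proof -
  obtain l c where v: "spectral_decomposition v l c"
    using spectral_decomposition_exists by blast
  then have c: "jordan_frame c" "v = (\<Sum>i<jrank TYPE('a). l i *\<^sub>R c i)"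
    by (auto simp: spectral_decomposition_def)
  define p where "p = (\<Sum>i<jrank TYPE('a). max (l i) 0 *\<^sub>R c i)"
  define n where "n = (\<Sum>i<jrank TYPE('a). max (- l i) 0 *\<^sub>R c i)"
  have sp: "spectral_decomposition p (\<lambda>i. max (l i) 0) c"
    and sn: "spectral_decomposition n (\<lambda>i. max (- l i) 0) c"
    using c by (auto simp: spectral_decomposition_def p_def n_def)
  have pn: "v = p - n"
    unfolding c(2) p_def n_def sum_subtractf[symmetric] scaleR_diff_left[symmetric]
    by (intro sum.cong) (auto simp: max_def)
  have p: "p \<in> square_cone" and n: "n \<in> square_cone"
    using square_cone_spectral[OF sp] square_cone_spectral[OF sn] by auto
  have "trace_inner n p = 0"
    unfolding spectral_trace_inner[OF sn sp] by (intro sum.neutral) (auto simp: max_def)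
  \<comment> \<open>The extra term for p - q yields uniqueness of the nearest point along with
    minimality, as \<open>THE\<close> demands.\<close>
  then have dist: "trace_inner (v - q) (v - q) \<ge> trace_inner (v - p) (v - p) + trace_inner (p - q) (p - q)"
    if "q \<in> square_cone" for q
    using square_cone_inner_nonneg[OF n that]
    by (simp add: pn trace.form_simps trace.form_commute[of p n]
        trace.form_commute[of q n] trace.form_commute[of q p]
        linear_neg[OF trace.linear_form_left] linear_neg[OF trace.linear_form_right])
  have "cone_proj v = p"
    unfolding cone_proj_def closure_sym_cone frob_norm_le_iff
  proof (intro the_equality conjI ballI)
    show "p \<in> square_cone" by fact
    show "trace_inner (v - p) (v - p) \<le> trace_inner (v - q) (v - q)" if "q \<in> square_cone" for q
      using dist[OF that] trace.form_nonneg[of "p - q"] by linarith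
    fix q
    assume q: "q \<in> square_cone \<and>
      (\<forall>qa\<in>square_cone. trace_inner (v - q) (v - q) \<le> trace_inner (v - qa) (v - qa))"
    then have "trace_inner (p - q) (p - q) \<le> 0"
      using dist[of q] p by force
    then show "q = p"
      using trace.form_pos[of "p - q"] by force
  qed
  then show "trace_inner v y \<le> trace_inner (cone_proj v) y" if "y \<in> square_cone"
    using square_cone_inner_nonneg[OF n that] by (simp add: pn trace.form_diff_left)
qed

text \<open>Gram-Schmidt for the trace form: the part of the new vector b orthogonal to the old span
  adds one correction term.\<close>

lemma trace_projection_exists:
  fixes x :: "'a::euclidean_jordan_algebra"
  assumes "finite B"
  shows "\<exists>p\<in>span B. \<forall>q\<in>span B. trace_inner (x - p) q = 0"
  using assms
proof (induction B arbitrary: x rule: finite_induct)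
  case (insert b B)
  obtain px where px: "px \<in> span B" "\<And>q. q \<in> span B \<Longrightarrow> trace_inner (x - px) q = 0"
    using insert.IH[of x] by blast
  obtain pb where pb: "pb \<in> span B" "\<And>q. q \<in> span B \<Longrightarrow> trace_inner (b - pb) q = 0"
    using insert.IH[of b] by blast
  show ?case
  proof (cases "b = pb")
    case True
    then have "span (insert b B) = span B"
      using pb by (simp add: span_redundant)
    then show ?thesis
      using px by auto
  next
    case False
    let ?b = "b - pb"
    define k where "k = trace_inner x ?b / trace_inner ?b ?b"
    have bb: "trace_inner ?b ?b \<noteq> 0"
      using False trace.form_eq_0_iff[of ?b] by simp
    have in_span: "s \<in> span (insert b B)" if "s \<in> span B" for s
      using that span_mono[of B "insert b B"] by blast
    have "px + k *\<^sub>R ?b \<in> span (insert b B)"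
      using in_span[OF px(1)] in_span[OF pb(1)]
      by (intro span_add span_scale span_diff) (auto intro: span_base)
    moreover have "trace_inner (x - (px + k *\<^sub>R ?b)) q = 0" if q: "q \<in> span (insert b B)" for q
    proof -
      obtain m where m: "q - m *\<^sub>R b \<in> span B"
        using q span_breakdown_eq by blast
      define s where "s = (q - m *\<^sub>R b) + m *\<^sub>R pb"
      have s: "s \<in> span B"
        unfolding s_def using m pb(1) by (intro span_add span_scale)
      have q_eq: "q = m *\<^sub>R ?b + s"
        by (simp add: s_def algebra_simps)
      have "trace_inner px ?b = 0"
        using pb(2)[OF px(1)] by (simp add: trace.form_commute)
      then have "trace_inner (x - (px + k *\<^sub>R ?b)) ?b = 0"
        using bb by (simp only: trace.form_add_left trace.form_diff_left[of x]
            trace.form_scaleR_left k_def) simp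
      moreover have "trace_inner (x - (px + k *\<^sub>R ?b)) s = trace_inner (x - px) s - k * trace_inner ?b s"
        by (simp add: trace.form_simps)
      then have "trace_inner (x - (px + k *\<^sub>R ?b)) s = 0"
        using px(2)[OF s] pb(2)[OF s] by simp
      ultimately show ?thesis
        unfolding q_eq by (simp only: trace.form_add_right trace.form_scaleR_right)
    qed
    ultimately show ?thesis by blast
  qed
qed simp

lemma subspace_proj:
  fixes x :: "'a::euclidean_jordan_algebra"
  assumes "subspace M"
  shows "subspace_proj M x \<in> M" "\<And>q. q \<in> M \<Longrightarrow> trace_inner (x - subspace_proj M x) q = 0"
proof -
  obtain B where "finite B" "span B = M"
    using basis_subspace_exists[OF assms] by metis
  then obtain p where p: "p \<in> M" "\<forall>q\<in>M. trace_inner (x - p) q = 0"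
    using trace_projection_exists by metis
  have unique: "p' = p" if "p' \<in> M \<and> (\<forall>q\<in>M. trace_inner (x - p') q = 0)" for p'
  proof -
    have "p' - p \<in> M"
      using that p assms by (auto intro: subspace_diff)
    then have "trace_inner (x - p) (p' - p) - trace_inner (x - p') (p' - p) = 0"
      using that p by simp
    then have "trace_inner (p' - p) (p' - p) = 0"
      by (simp add: trace.form_diff_left)
    then show ?thesis
      by (simp add: trace.form_eq_0_iff)
  qed
  have "subspace_proj M x \<in> M \<and> (\<forall>q\<in>M. trace_inner (x - subspace_proj M x) q = 0)"
    unfolding subspace_proj_def
  proof (rule theI[of _ p])
    show "p \<in> M \<and> (\<forall>q\<in>M. trace_inner (x - p) q = 0)"
      using p by blast
  qed (rule unique)
  then show "subspace_proj M x \<in> M" "\<And>q. q \<in> M \<Longrightarrow> trace_inner (x - subspace_proj M x) q = 0"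
    by blast+
qed

lemma subspace_proj_ident:
  assumes "subspace M" "x \<in> M"
  shows "subspace_proj M x = x"
proof -
  have "x - subspace_proj M x \<in> M"
    using assms subspace_proj(1) by (blast intro: subspace_diff)
  then have "trace_inner (x - subspace_proj M x) (x - subspace_proj M x) = 0"
    by (rule subspace_proj(2)[OF assms(1)])
  then show ?thesis
    by (simp add: trace.form_eq_0_iff)
qed

text \<open>Turns identities between linear combinations of vectors into identities of real
  polynomials.\<close>

lemma vector_eq_inner: "(\<And>w. w \<bullet> x = w \<bullet> y) \<Longrightarrow> x = y" for x :: "'a::real_inner"
  by (rule iffD1[OF vector_eq_ldot]) blast

text \<open>The quadratic map of $v = e + (t-1) c$ with $c$ primitive, as $2 c(cx) - cx = \langle c, x\rangle c$;
  it acts by $t^2, t, 1$ on the Peirce spaces of $c$.\<close>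

definition scale_map :: "'a::euclidean_jordan_algebra \<Rightarrow> real \<Rightarrow> 'a \<Rightarrow> 'a" where
  "scale_map c t x = x + (2 * (t - 1)) *\<^sub>R (c \<circ>\<^sub>J x) + ((t - 1)\<^sup>2 * trace_inner c x) *\<^sub>R c"

lemma primitive_mult_twice:
  assumes "primitive_idempotent c"
  shows "c \<circ>\<^sub>J (c \<circ>\<^sub>J x) = (1/2) *\<^sub>R (c \<circ>\<^sub>J x + trace_inner c x *\<^sub>R c)"
proof -
  have "2 *\<^sub>R (c \<circ>\<^sub>J (c \<circ>\<^sub>J x)) = c \<circ>\<^sub>J x + trace_inner c x *\<^sub>R c"
    using trace.primitive_quad[OF assms, of x] by (simp add: trace_inner_primitive[OF assms] algebra_simps)
  then show ?thesis
    by (metis scaleR_half_double scaleR_2 scaleR_right_distrib)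
qed

lemma quad_map_scale_map:
  assumes "primitive_idempotent c"
  shows "quad_map (junit + a *\<^sub>R c) = scale_map c (1 + a)"
proof
  fix x
  have "quad_map (junit + a *\<^sub>R c) x =
      x + (2 * a) *\<^sub>R (c \<circ>\<^sub>J x) + a\<^sup>2 *\<^sub>R (2 *\<^sub>R (c \<circ>\<^sub>J (c \<circ>\<^sub>J x)) - c \<circ>\<^sub>J x)"
    unfolding quad_map_def jprod_simps primitive_idempotentD(3)[OF assms] jprod_unit_left jprod_unit
    by (rule vector_eq_inner) (simp add: inner_add_right inner_diff_right inner_scaleR_right power2_eq_square algebra_simps)
  then show "quad_map (junit + a *\<^sub>R c) x = scale_map c (1 + a) x"
    by (simp add: trace.primitive_quad[OF assms] trace_inner_primitive[OF assms] scale_map_def)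
qed

lemma linear_scale_map: "linear (scale_map c t)"
  by (rule linearI) (simp_all add: scale_map_def jprod_simps trace.form_simps algebra_simps)

lemma scale_map_1 [simp]: "scale_map c 1 x = x"
  by (simp add: scale_map_def)

lemma trace_inner_scale_map: "trace_inner (scale_map c t x) y = trace_inner x (scale_map c t y)"
  by (simp add: scale_map_def trace.form_simps trace.form_move trace.form_commute[of x c])

lemma trace_inner_primitive_jprod:
  "primitive_idempotent c \<Longrightarrow> trace_inner c (c \<circ>\<^sub>J x) = trace_inner c x"
  by (simp add: primitive_idempotentD(3) flip: trace.form_assoc)

lemma trace_inner_primitive_scale_map:
  assumes "primitive_idempotent c"
  shows "trace_inner c (scale_map c t x) = t\<^sup>2 * trace_inner c x"
  by (simp add: scale_map_def trace.form_simps trace_inner_primitive_jprod[OF assms]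
      trace_inner_primitive[OF assms] power2_eq_square algebra_simps)

text \<open>A one-parameter group, as the Peirce eigenvalues t^2, t, 1 suggest. It gives the inverse
  (parameter 1/t), the increments of the determinant, and the norm of the rescaled vector.\<close>

lemma scale_map_mult:
  assumes "primitive_idempotent c"
  shows "scale_map c s (scale_map c t x) = scale_map c (s * t) x"
proof -
  have "c \<circ>\<^sub>J scale_map c t x = c \<circ>\<^sub>J x + (2 * (t - 1)) *\<^sub>R (c \<circ>\<^sub>J (c \<circ>\<^sub>J x))
      + ((t - 1)\<^sup>2 * trace_inner c x) *\<^sub>R c"
    by (simp add: scale_map_def jprod_simps primitive_idempotentD(3)[OF assms])
  also have "\<dots> = c \<circ>\<^sub>J x + (t - 1) *\<^sub>R (c \<circ>\<^sub>J x + trace_inner c x *\<^sub>R c)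
      + ((t - 1)\<^sup>2 * trace_inner c x) *\<^sub>R c"
    by (simp add: primitive_mult_twice[OF assms])
  also have "\<dots> = t *\<^sub>R (c \<circ>\<^sub>J x) + (t * (t - 1) * trace_inner c x) *\<^sub>R c"
    by (rule vector_eq_inner) (simp add: inner_add_right inner_diff_right inner_scaleR_right power2_eq_square algebra_simps)
  finally have mult: "c \<circ>\<^sub>J scale_map c t x = t *\<^sub>R (c \<circ>\<^sub>J x) + (t * (t - 1) * trace_inner c x) *\<^sub>R c" .
  show ?thesis
    unfolding scale_map_def[of c s] trace_inner_primitive_scale_map[OF assms] mult
    unfolding scale_map_def
    by (rule vector_eq_inner) (simp add: inner_add_right inner_diff_right inner_scaleR_right power2_eq_square algebra_simps)
qed

lemma scale_map_junit:
  assumes "primitive_idempotent c"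
  shows "scale_map c t junit = junit + (t\<^sup>2 - 1) *\<^sub>R c"
  unfolding scale_map_def trace_inner_junit jtrace_primitive[OF assms] jprod_unit
  by (rule vector_eq_inner) (simp add: inner_add_right inner_diff_right inner_scaleR_right power2_eq_square algebra_simps)

text \<open>The linearised identity with arguments c, c, d, d, reduced by
  \<open>primitive_mult_twice\<close>; it closes the span of c, d and their product under
  multiplication.\<close>

lemma jprod_primitives_square:
  assumes "primitive_idempotent c" "primitive_idempotent d"
  shows "4 *\<^sub>R ((c \<circ>\<^sub>J d) \<circ>\<^sub>J (c \<circ>\<^sub>J d)) = trace_inner c d *\<^sub>R (c + d + 2 *\<^sub>R (c \<circ>\<^sub>J d))"
proof -
  define p where "p = c \<circ>\<^sub>J d"
  define s where "s = trace_inner c d"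
  note cd = primitive_idempotentD(3)[OF assms(1)] primitive_idempotentD(3)[OF assms(2)]
  have cp: "c \<circ>\<^sub>J p = (1/2) *\<^sub>R (p + s *\<^sub>R c)" and dp: "d \<circ>\<^sub>J p = (1/2) *\<^sub>R (p + s *\<^sub>R d)"
    using primitive_mult_twice[OF assms(1), of d] primitive_mult_twice[OF assms(2), of c]
    unfolding p_def s_def jprod_commute[of d c] trace.form_commute[of d c] .
  have "c \<circ>\<^sub>J (d \<circ>\<^sub>J p) + c \<circ>\<^sub>J (d \<circ>\<^sub>J p) + d \<circ>\<^sub>J p = p \<circ>\<^sub>J p + p \<circ>\<^sub>J p + p"
    using jordan_identity_linearised[of c c d d]
    unfolding cd jprod_commute[of d c] p_def[symmetric] jprod_commute[of p d] .
  then have "2 *\<^sub>R (p \<circ>\<^sub>J p) = 2 *\<^sub>R (c \<circ>\<^sub>J (d \<circ>\<^sub>J p)) + d \<circ>\<^sub>J p - p"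
    unfolding scaleR_2 by (metis add_diff_cancel_right')
  moreover have "c \<circ>\<^sub>J (d \<circ>\<^sub>J p) = (1/4) *\<^sub>R (p + s *\<^sub>R c) + (s/2) *\<^sub>R p"
    unfolding dp jprod_simps cp p_def[symmetric]
    by (rule vector_eq_inner) (simp add: inner_add_right inner_diff_right inner_scaleR_right algebra_simps)
  ultimately have "2 *\<^sub>R (p \<circ>\<^sub>J p) = 2 *\<^sub>R ((1/4) *\<^sub>R (p + s *\<^sub>R c) + (s/2) *\<^sub>R p)
      + (1/2) *\<^sub>R (p + s *\<^sub>R d) - p"
    by (simp only: dp)
  also have "\<dots> = (s / 2) *\<^sub>R (c + d + 2 *\<^sub>R p)"
    by (rule vector_eq_inner) (simp add: inner_add_right inner_diff_right inner_scaleR_right algebra_simps)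
  finally have "2 *\<^sub>R (2 *\<^sub>R (p \<circ>\<^sub>J p)) = 2 *\<^sub>R ((s / 2) *\<^sub>R (c + d + 2 *\<^sub>R p))"
    by simp
  then show ?thesis
    by (simp add: p_def s_def)
qed

lemma trace_inner_primitives:
  assumes "primitive_idempotent c" "primitive_idempotent d"
  shows "0 \<le> trace_inner c d" "trace_inner c d \<le> 1"
proof -
  show "0 \<le> trace_inner c d"
    using trace.form_idempotents(1) assms primitive_idempotentD(1) by blast
  have "(trace_inner c d)\<^sup>2 \<le> 1\<^sup>2"
    using trace.form_Cauchy_Schwarz[of c d] by (simp add: trace_inner_primitive assms)
  then show "trace_inner c d \<le> 1"
    by (rule power2_le_imp_le) simp
qed

text \<open>The factor is the trace of the image of d. When it is positive, the image is a positive
  multiple of an idempotent, which is how membership in the cone is obtained.\<close>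

lemma scale_map_primitive_square:
  assumes "primitive_idempotent c" "primitive_idempotent d"
  shows "scale_map c t d \<circ>\<^sub>J scale_map c t d = (1 + (t\<^sup>2 - 1) * trace_inner c d) *\<^sub>R scale_map c t d"
proof -
  define p where "p = c \<circ>\<^sub>J d"
  define s where "s = trace_inner c d"
  define a where "a = t - 1"
  note cd = primitive_idempotentD(3)[OF assms(1)] primitive_idempotentD(3)[OF assms(2)]
  have cp: "c \<circ>\<^sub>J p = (1/2) *\<^sub>R (p + s *\<^sub>R c)" and dp: "d \<circ>\<^sub>J p = (1/2) *\<^sub>R (p + s *\<^sub>R d)"
    using primitive_mult_twice[OF assms(1), of d] primitive_mult_twice[OF assms(2), of c]
    unfolding p_def s_def jprod_commute[of d c] trace.form_commute[of d c] .
  have pp: "p \<circ>\<^sub>J p = (s/4) *\<^sub>R (c + d + 2 *\<^sub>R p)"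
  proof -
    have "(1/4::real) *\<^sub>R (4 *\<^sub>R (p \<circ>\<^sub>J p)) = (1/4) *\<^sub>R (s *\<^sub>R (c + d + 2 *\<^sub>R p))"
      using jprod_primitives_square[OF assms] by (simp add: p_def s_def)
    then show ?thesis by simp
  qed
  have comm: "d \<circ>\<^sub>J c = p" "c \<circ>\<^sub>J d = p" "p \<circ>\<^sub>J c = c \<circ>\<^sub>J p" "p \<circ>\<^sub>J d = d \<circ>\<^sub>J p"
    by (simp_all add: p_def jprod_commute)
  have w: "scale_map c t d = d + (2 * a) *\<^sub>R p + (a\<^sup>2 * s) *\<^sub>R c"
    by (simp add: scale_map_def p_def s_def a_def)
  have "scale_map c t d \<circ>\<^sub>J scale_map c t d = d + (4 * a) *\<^sub>R (d \<circ>\<^sub>J p) + (2 * a\<^sup>2 * s) *\<^sub>R p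
      + (4 * a\<^sup>2) *\<^sub>R (p \<circ>\<^sub>J p) + (4 * a ^ 3 * s) *\<^sub>R (c \<circ>\<^sub>J p) + (a ^ 4 * s\<^sup>2) *\<^sub>R c"
    unfolding w
    unfolding jprod_simps cd comm
    by (rule vector_eq_inner)
      (simp add: inner_add_right inner_diff_right inner_scaleR_right power2_eq_square power3_eq_cube power4_eq_xxxx algebra_simps)
  also have "\<dots> = d + (2 * a) *\<^sub>R (p + s *\<^sub>R d) + (2 * a\<^sup>2 * s) *\<^sub>R p
      + (a\<^sup>2 * s) *\<^sub>R (c + d + 2 *\<^sub>R p) + (2 * a ^ 3 * s) *\<^sub>R (p + s *\<^sub>R c) + (a ^ 4 * s\<^sup>2) *\<^sub>R c"
    by (simp add: pp cp dp)
  also have "\<dots> = (1 + (2 * a + a\<^sup>2) * s) *\<^sub>R (d + (2 * a) *\<^sub>R p + (a\<^sup>2 * s) *\<^sub>R c)"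
    by (rule vector_eq_inner)
      (simp add: inner_add_right inner_diff_right inner_scaleR_right power2_eq_square power3_eq_cube power4_eq_xxxx algebra_simps)
  also have "2 * a + a\<^sup>2 = t\<^sup>2 - 1"
    by (simp add: a_def power2_eq_square algebra_simps)
  finally show ?thesis
    by (simp add: w s_def)
qed

lemma scale_map_primitive_square_cone:
  assumes "primitive_idempotent c" "primitive_idempotent d" "t > 0"
  shows "scale_map c t d \<in> square_cone"
proof -
  let ?w = "scale_map c t d"
  define k where "k = 1 + (t\<^sup>2 - 1) * trace_inner c d"
  \<comment> \<open>With s = \<open>trace_inner c d\<close> in the unit interval, k = (1 - s) + t^2
    s.\<close>
  have "k > 0"
  proof (cases "trace_inner c d = 0")
    case False
    then have "t\<^sup>2 * trace_inner c d > 0"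
      using trace_inner_primitives(1)[OF assms(1,2)] assms(3) by (simp add: less_le)
    then show ?thesis
      using trace_inner_primitives(2)[OF assms(1,2)] by (simp add: k_def algebra_simps)
  qed (simp add: k_def)
  have "?w \<circ>\<^sub>J ?w = k *\<^sub>R ?w"
    using scale_map_primitive_square[OF assms(1,2)] by (simp add: k_def)
  then have "idempotent ((1 / k) *\<^sub>R ?w)"
    using \<open>k > 0\<close> by (simp add: idempotent_def jprod_simps)
  then have "k *\<^sub>R ((1 / k) *\<^sub>R ?w) \<in> square_cone"
    using \<open>k > 0\<close> by (intro square_cone_scaleR idempotent_square_cone) auto
  then show ?thesis
    using \<open>k > 0\<close> by simp
qed

text \<open>The map is self-adjoint, so by the dual description of the cone its images of primitives
  decide.\<close>

lemma scale_map_square_cone: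
  assumes "primitive_idempotent c" "t > 0" "x \<in> square_cone"
  shows "scale_map c t x \<in> square_cone"
  unfolding square_cone_iff
proof (intro allI impI)
  fix p :: 'a assume "primitive_idempotent p"
  then have "trace_inner x (scale_map c t p) \<ge> 0"
    using assms by (intro square_cone_inner_nonneg scale_map_primitive_square_cone)
  then show "trace_inner (scale_map c t x) p \<ge> 0"
    by (simp add: trace_inner_scale_map)
qed

text \<open>The unit goes to (e - c) + t^2 c, which exceeds k e by a cone element. The margin m to
  the boundary thus shrinks at most by the factor k.\<close>

lemma scale_map_shift:
  assumes "primitive_idempotent c" "t > 0" "x - m *\<^sub>R junit \<in> square_cone" "m \<ge> 0"
    and "k \<le> 1" "k \<le> t\<^sup>2"
  shows "scale_map c t x - (m * k) *\<^sub>R junit \<in> square_cone"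
proof -
  have "scale_map c t (x - m *\<^sub>R junit) + m *\<^sub>R ((1 - k) *\<^sub>R (junit - c) + (t\<^sup>2 - k) *\<^sub>R c) \<in> square_cone"
    using assms idempotent_square_cone primitive_idempotentD(1)[OF assms(1)]
    by (intro square_cone_add square_cone_scaleR scale_map_square_cone)
      (auto intro: idempotent_diff_unit)
  also have "scale_map c t (x - m *\<^sub>R junit) + m *\<^sub>R ((1 - k) *\<^sub>R (junit - c) + (t\<^sup>2 - k) *\<^sub>R c)
      = scale_map c t x - (m * k) *\<^sub>R junit"
    by (simp add: linear_diff[OF linear_scale_map] linear_scale[OF linear_scale_map]
        scale_map_junit[OF assms(1)] algebra_simps)
  finally show ?thesis .
qed

lemma scale_map_sym_cone_iff:
  assumes "primitive_idempotent c" "t > 0"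
  shows "scale_map c t x \<in> sym_cone \<longleftrightarrow> x \<in> sym_cone"
proof -
  have *: "scale_map c t x \<in> sym_cone" if t: "t > 0" and x: "x \<in> sym_cone" for t x
  proof -
    obtain m where m: "m > 0" "x - m *\<^sub>R junit \<in> square_cone"
      using x sym_cone_iff_shift by blast
    then have "scale_map c t x - (m * min 1 (t\<^sup>2)) *\<^sub>R junit \<in> square_cone"
      using assms(1) t by (intro scale_map_shift) auto
    then show ?thesis
      using m(1) t unfolding sym_cone_iff_shift by (intro exI[of _ "m * min 1 (t\<^sup>2)"]) simp
  qed
  have "scale_map c (1 / t) (scale_map c t x) = x"
    using assms by (simp add: scale_map_mult)
  then show ?thesis
    using *[of t x] *[of "1 / t" "scale_map c t x"] assms(2) by auto
qed

lemma bij_scale_map: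
  assumes "primitive_idempotent c" "t > 0"
  shows "bij (scale_map c t)"
  using assms
  by (intro o_bij[of "scale_map c (1 / t)"]) (auto simp: scale_map_mult)

subsection \<open>The determinant\<close>

text \<open>\<open>spectral_sum_unique\<close> speaks about sums, so independence of the chosen
  eigenvalues is reached through \<open>ln\<close>, injective on positive numbers.\<close>

lemma jdet_sym_cone:
  fixes c :: "nat \<Rightarrow> 'a::euclidean_jordan_algebra"
  assumes "spectral_decomposition x l c" "x \<in> sym_cone"
  shows "jdet x = (\<Prod>i<jrank TYPE('a). l i)" "jdet x > 0"
    "ln (jdet x) = (\<Sum>i<jrank TYPE('a). ln (l i))"
proof -
  obtain d where d: "spectral_decomposition x (eigval x) d"
    using spectral_decomposition_eigval by blast
  have pos: "eigval x i > 0" "l i > 0" if "i < jrank TYPE('a)" for i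
    using sym_cone_spectral[OF d] sym_cone_spectral[OF assms(1)] assms(2) that by auto
  show "jdet x > 0"
    unfolding jdet_def by (rule prod_pos) (simp add: pos)
  have "ln (jdet x) = (\<Sum>i<jrank TYPE('a). ln (eigval x i))"
    unfolding jdet_def by (rule ln_prod) (use pos in force)+
  then show ln: "ln (jdet x) = (\<Sum>i<jrank TYPE('a). ln (l i))"
    using spectral_sum_unique[OF d assms(1), of ln] by simp
  have "(\<Prod>i<jrank TYPE('a). l i) > 0"
    by (rule prod_pos) (simp add: pos)
  moreover have "ln (\<Prod>i<jrank TYPE('a). l i) = (\<Sum>i<jrank TYPE('a). ln (l i))"
    by (rule ln_prod) (use pos in force)+
  ultimately show "jdet x = (\<Prod>i<jrank TYPE('a). l i)"
    using ln \<open>jdet x > 0\<close> by (metis ln_inj_iff)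
qed

lemma jdet_pos: "x \<in> sym_cone \<Longrightarrow> jdet x > 0"
  using jdet_sym_cone(2) spectral_decomposition_exists by blast

text \<open>Klein's inequality for the concave function $\ln$; the sum is the inverse of $x$.\<close>

lemma ln_jdet_le:
  fixes c :: "nat \<Rightarrow> 'a::euclidean_jordan_algebra"
  assumes x: "spectral_decomposition x l c" "x \<in> sym_cone" and "y \<in> sym_cone"
  shows "ln (jdet y) \<le> ln (jdet x)
    + trace_inner (\<Sum>i<jrank TYPE('a). inverse (l i) *\<^sub>R c i) y - real (jrank TYPE('a))"
proof -
  let ?r = "jrank TYPE('a)"
  obtain m d where y: "spectral_decomposition y m d"
    using spectral_decomposition_exists by blast
  have cd: "jordan_frame c" "jordan_frame d" and y_eq: "y = (\<Sum>i<?r. m i *\<^sub>R d i)"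
    using x y by (auto simp: spectral_decomposition_def)
  let ?w = "\<lambda>i j. trace_inner (c i) (d j)"
  have l: "l i > 0" if "i < ?r" for i
    using sym_cone_spectral[OF x(1)] x(2) that by blast
  have m: "m i > 0" if "i < ?r" for i
    using sym_cone_spectral[OF y] assms(3) that by blast
  have "ln (jdet y) - ln (jdet x) = (\<Sum>j<?r. ln (m j)) - (\<Sum>i<?r. ln (l i))"
    using jdet_sym_cone(3)[OF x] jdet_sym_cone(3)[OF y assms(3)] by simp
  \<comment> \<open>With common nonnegative weights, ln t <= t - 1 can be applied to each pair of
    eigenvalues.\<close>
  also have "\<dots> = (\<Sum>i<?r. \<Sum>j<?r. (ln (m j) - ln (l i)) * ?w i j)"
    unfolding frames_sum_weights(1)[OF cd, of "\<lambda>i. ln (l i)"]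
      frames_sum_weights(2)[OF cd, of "\<lambda>j. ln (m j)"]
    by (simp add: left_diff_distrib sum_subtractf)
  also have "\<dots> \<le> (\<Sum>i<?r. \<Sum>j<?r. (inverse (l i) * m j - 1) * ?w i j)"
  proof (intro sum_mono mult_right_mono)
    fix i j assume ij: "i \<in> {..<?r}" "j \<in> {..<?r}"
    then have "ln (m j) - ln (l i) = ln (m j / l i)"
      using l[of i] m[of j] by (simp add: ln_div)
    also have "\<dots> \<le> m j / l i - 1"
      using l m ij by (intro ln_le_minus_one) simp
    finally show "ln (m j) - ln (l i) \<le> inverse (l i) * m j - 1"
      by (simp add: field_simps)
    show "0 \<le> ?w i j"
      using frames_doubly_stochastic(1)[OF cd] ij by simp
  qed
  also have "\<dots> = (\<Sum>i<?r. \<Sum>j<?r. inverse (l i) * m j * ?w i j) - (\<Sum>i<?r. \<Sum>j<?r. 1 * ?w i j)"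
    by (simp only: left_diff_distrib sum_subtractf)
  also have "(\<Sum>i<?r. \<Sum>j<?r. 1 * ?w i j) = real ?r"
    unfolding frames_sum_weights(1)[OF cd, of "\<lambda>_. 1", symmetric] by simp
  also have "(\<Sum>i<?r. \<Sum>j<?r. inverse (l i) * m j * ?w i j)
      = trace_inner (\<Sum>i<?r. inverse (l i) *\<^sub>R c i) y"
    unfolding y_eq by (subst sum.swap) (simp add: trace.form_sum_left trace.form_sum_right
        trace.form_scaleR_left trace.form_scaleR_right sum_distrib_left mult_ac)
  finally show ?thesis by simp
qed

lemma trace_inner_primitive_nonneg:
  assumes "primitive_idempotent c" "x \<in> sym_cone"
  shows "trace_inner c x \<ge> 0"
  using assms sym_cone_subset square_cone_iff[of x] by (auto simp: trace.form_commute[of c x])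

text \<open>Klein's inequality with z the inverse of x: the linear term is exact because <z, cx> =
  <zx, c> = 1, and <z, c> <= 1/m since all eigenvalues of x are at least m.\<close>

lemma ln_jdet_scale_map_le:
  fixes x :: "'a::euclidean_jordan_algebra"
  assumes c: "primitive_idempotent c" and "t > 0" and x: "x \<in> sym_cone"
    and m: "m > 0" "x - m *\<^sub>R junit \<in> square_cone"
  shows "ln (jdet (scale_map c t x)) \<le> ln (jdet x) + 2 * (t - 1) + (t - 1)\<^sup>2 * (trace_inner c x / m)"
proof -
  let ?r = "jrank TYPE('a)"
  obtain l f where lf: "spectral_decomposition x l f"
    using spectral_decomposition_exists by blast
  then have f: "jordan_frame f" "\<And>i. i < ?r \<Longrightarrow> primitive_idempotent (f i)"
    by (auto simp: spectral_decomposition_def jordan_frame_def)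
  define z where "z = (\<Sum>i<?r. inverse (l i) *\<^sub>R f i)"
  have z: "spectral_decomposition z (\<lambda>i. inverse (l i)) f"
    using f by (simp add: spectral_decomposition_def z_def)
  have l: "l i \<ge> m" if "i < ?r" for i
    using square_cone_spectral[OF spectral_decomposition_affine[OF lf, of 1 "- m"]] m that by simp
  have "z \<circ>\<^sub>J x = (\<Sum>i<?r. f i)"
    unfolding spectral_jprod[OF z lf] using l m(1) by (intro sum.cong) force+
  then have zx: "z \<circ>\<^sub>J x = junit"
    using f by (simp add: jordan_frame_def)
  have "trace_inner z (c \<circ>\<^sub>J x) = trace_inner (z \<circ>\<^sub>J x) c"
    by (simp add: trace.form_assoc jprod_commute[of c x])
  then have 1: "trace_inner z (c \<circ>\<^sub>J x) = 1"
    by (simp add: zx jtrace_primitive[OF c])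
  have 2: "trace_inner z x = real ?r"
    using zx by (simp add: trace_inner_def jtrace_unit)
  have fc: "trace_inner (f i) c \<ge> 0" if "i < ?r" for i
    using trace_inner_primitives(1)[OF f(2)[OF that] c] .
  have "trace_inner z c = (\<Sum>i<?r. inverse (l i) * trace_inner (f i) c)"
    by (simp add: z_def trace.form_sum_left trace.form_scaleR_left)
  also have "\<dots> \<le> (\<Sum>i<?r. inverse m * trace_inner (f i) c)"
    using l m(1) fc by (intro sum_mono mult_right_mono le_imp_inverse_le) auto
  also have "\<dots> = inverse m * trace_inner (\<Sum>i<?r. f i) c"
    by (simp add: trace.form_sum_left sum_distrib_left)
  also have "\<dots> = inverse m"
    using f(1) jtrace_primitive[OF c] by (simp add: jordan_frame_def)
  finally have 3: "trace_inner z c \<le> inverse m" .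
  have "trace_inner c x \<ge> 0"
    by (rule trace_inner_primitive_nonneg[OF c x])
  then have "(t - 1)\<^sup>2 * trace_inner c x * trace_inner z c \<le> (t - 1)\<^sup>2 * trace_inner c x * inverse m"
    using 3 by (intro mult_left_mono) auto
  moreover have "trace_inner z (scale_map c t x)
      = real ?r + 2 * (t - 1) + (t - 1)\<^sup>2 * trace_inner c x * trace_inner z c"
    by (simp add: scale_map_def trace.form_add_right trace.form_scaleR_right 1 2)
  moreover have "ln (jdet (scale_map c t x)) \<le> ln (jdet x) + trace_inner z (scale_map c t x) - real ?r"
    unfolding z_def by (rule ln_jdet_le[OF lf x]) (simp add: scale_map_sym_cone_iff c assms x)
  ultimately show ?thesis
    by (simp add: divide_inverse mult.assoc)
qed

text \<open>Exchanging s and t makes the one-sided bound two-sided, so g has derivative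
  zero.\<close>

lemma constant_if_quadratic_increments:
  fixes g :: "real \<Rightarrow> real"
  assumes "\<And>s t. s \<in> {a..b} \<Longrightarrow> t \<in> {a..b} \<Longrightarrow> g t - g s \<le> C * (t - s)\<^sup>2" "a \<le> b"
  shows "g b = g a"
proof -
  have "(g has_real_derivative 0) (at s within {a..b})" if s: "s \<in> {a..b}" for s
    unfolding has_field_derivative_iff
  proof (rule Lim_null_comparison)
    have "norm ((g t - g s) / (t - s)) \<le> C * \<bar>t - s\<bar>" if "t \<in> {a..b}" "t \<noteq> s" for t
    proof -
      have "\<bar>g t - g s\<bar> \<le> C * \<bar>t - s\<bar> * \<bar>t - s\<bar>"
        using assms(1)[OF s that(1)] assms(1)[OF that(1) s]
        by (simp add: power2_eq_square abs_le_iff algebra_simps)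
      then show ?thesis
        using that(2) by (simp add: abs_divide pos_divide_le_eq)
    qed
    then show "\<forall>\<^sub>F t in at s within {a..b}. norm ((g t - g s) / (t - s)) \<le> C * \<bar>t - s\<bar>"
      by (auto simp: eventually_at_filter)
    have "((\<lambda>t. C * \<bar>t - s\<bar>) \<longlongrightarrow> C * \<bar>s - s\<bar>) (at s within {a..b})"
      by (intro tendsto_intros)
    then show "((\<lambda>t. C * \<bar>t - s\<bar>) \<longlongrightarrow> 0) (at s within {a..b})"
      by simp
  qed
  then obtain k where "\<And>s. s \<in> {a..b} \<Longrightarrow> g s = k"
    using has_field_derivative_zero_constant[of "{a..b}" g] by auto
  then show ?thesis
    using assms(2) by simp
qed

text \<open>By the previous estimate the increments of $\ln\det(D_{e+(t-1)c}x) - 2 \ln t$ are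
  quadratically small.\<close>

lemma jdet_scale_map:
  fixes x :: "'a::euclidean_jordan_algebra"
  assumes c: "primitive_idempotent c" and "t \<ge> 1" and x: "x \<in> sym_cone"
  shows "jdet (scale_map c t x) = t\<^sup>2 * jdet x"
proof -
  obtain m where m: "m > 0" "x - m *\<^sub>R junit \<in> square_cone"
    using x sym_cone_iff_shift by blast
  define g where "g s = ln (jdet (scale_map c s x)) - 2 * ln s" for s
  define K where "K = t\<^sup>2 * trace_inner c x / m"
  have cx: "trace_inner c x \<ge> 0"
    by (rule trace_inner_primitive_nonneg[OF c x])
  have "g t = g 1"
  proof (rule constant_if_quadratic_increments[where g = g and C = "K + 2 * t"])
    fix s u assume su: "s \<in> {1..t}" "u \<in> {1..t}"
    \<comment> \<open>The map with parameter u is the one with parameter q applied after the one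
      with s, so the estimate is used at the intermediate point.\<close>
    define q where "q = u / s"
    have q: "q > 0" "q * s = u"
      using su by (auto simp: q_def)
    \<comment> \<open>For s >= 1 the margin m of x serves along the whole path, which makes the
      quadratic constant uniform.\<close>
    have "scale_map c s x - (m * 1) *\<^sub>R junit \<in> square_cone"
      using su m by (intro scale_map_shift[OF c]) (auto simp: power2_eq_square intro: order_trans[OF _ mult_mono[of 1 s 1 s]])
    moreover have "scale_map c s x \<in> sym_cone"
      using su x by (simp add: scale_map_sym_cone_iff[OF c])
    ultimately have "ln (jdet (scale_map c q (scale_map c s x))) \<le> ln (jdet (scale_map c s x))
        + 2 * (q - 1) + (q - 1)\<^sup>2 * (trace_inner c (scale_map c s x) / m)"
      using q m by (intro ln_jdet_scale_map_le[OF c]) auto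
    then have "g u - g s \<le> 2 * (q - 1) + (q - 1)\<^sup>2 * (s\<^sup>2 * trace_inner c x / m) - 2 * (ln u - ln s)"
      by (simp add: g_def scale_map_mult[OF c] q trace_inner_primitive_scale_map[OF c])
    also have "ln u - ln s = - ln (1 / q)"
      using su by (simp add: q_def ln_div)
    also have "2 * (q - 1) + (q - 1)\<^sup>2 * (s\<^sup>2 * trace_inner c x / m) - 2 * (- ln (1 / q))
        \<le> 2 * (q - 1) + (q - 1)\<^sup>2 * K + 2 * (1 / q - 1)"
    proof -
      have "ln (1 / q) \<le> 1 / q - 1"
        using q by (intro ln_le_minus_one) simp
      moreover have "s\<^sup>2 * trace_inner c x / m \<le> K"
        unfolding K_def using su m cx by (intro divide_right_mono mult_right_mono power_mono) auto
      then have "(q - 1)\<^sup>2 * (s\<^sup>2 * trace_inner c x / m) \<le> (q - 1)\<^sup>2 * K"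
        by (intro mult_left_mono) auto
      moreover have "h + a - 2 * - b \<le> h + a' + 2 * b'" if "b \<le> b'" "a \<le> a'" for h a a' b b' :: real
        using that by linarith
      ultimately show ?thesis by blast
    qed
    \<comment> \<open>The first-order terms combine to 2(q - 1) + 2(1/q - 1) = 2(q - 1)^2 /
      q.\<close>
    also have "\<dots> = (q - 1)\<^sup>2 * (K + 2 / q)"
      using q by (simp add: field_simps power2_eq_square)
    also have "\<dots> \<le> (u - s)\<^sup>2 * (K + 2 * t)"
    proof (rule mult_mono)
      have "q - 1 = (u - s) / s"
        using su by (simp add: q_def field_simps)
      then have "\<bar>q - 1\<bar> \<le> \<bar>u - s\<bar>"
        using su by (simp add: abs_divide divide_le_eq mult_le_cancel_left1)
      then show "(q - 1)\<^sup>2 \<le> (u - s)\<^sup>2"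
        by (simp add: abs_le_square_iff)
      have "2 / q = 2 * s / u"
        by (simp add: q_def)
      also have "\<dots> \<le> 2 * t / 1"
        using su by (intro frac_le) auto
      finally show "K + 2 / q \<le> K + 2 * t"
        by simp
      show "0 \<le> K + 2 / q"
        using cx m q by (simp add: K_def)
    qed simp
    finally show "g u - g s \<le> (K + 2 * t) * (u - s)\<^sup>2"
      by (simp add: mult.commute)
  qed (rule assms(2))
  then have "ln (jdet (scale_map c t x)) = ln (jdet x) + 2 * ln t"
    by (simp add: g_def)
  also have "\<dots> = ln (t\<^sup>2 * jdet x)"
    using jdet_pos[OF x] assms(2) by (simp add: ln_mult ln_realpow)
  finally show ?thesis
    using jdet_pos[OF x] jdet_pos[of "scale_map c t x"] assms
    by (simp add: scale_map_sym_cone_iff[OF c])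
qed

subsection \<open>The algorithm\<close>

definition normalized_det :: "'a::euclidean_jordan_algebra \<Rightarrow> real" where
  "normalized_det x = jdet x / (frob_norm x / sqrt (real (jrank TYPE('a)))) ^ jrank TYPE('a)"

lemma zero_notin_sym_cone: "(0 :: 'a::euclidean_jordan_algebra) \<notin> sym_cone"
proof
  assume *: "(0 :: 'a) \<in> sym_cone"
  obtain l and c :: "nat \<Rightarrow> 'a" where c: "spectral_decomposition 0 l c"
    using spectral_decomposition_exists by blast
  then have "spectral_decomposition (0 :: 'a) (\<lambda>_. 0) c"
    by (simp add: spectral_decomposition_def)
  then show False
    using * sym_cone_spectral jrank_pos[where 'a='a] by blast
qed

lemma frob_norm_pos: "x \<in> sym_cone \<Longrightarrow> frob_norm x > 0"
  using zero_notin_sym_cone trace.form_pos[of x] by (auto simp: frob_norm_def)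

lemma spectral_frob_norm:
  fixes c :: "nat \<Rightarrow> 'a::euclidean_jordan_algebra"
  assumes "spectral_decomposition x l c"
  shows "(frob_norm x)\<^sup>2 = (\<Sum>i<jrank TYPE('a). (l i)\<^sup>2)"
  unfolding frob_norm_square spectral_trace_inner[OF assms assms] by (simp add: power2_eq_square)

lemma normalized_det_pos: "x \<in> sym_cone \<Longrightarrow> normalized_det x > 0"
  using jdet_pos[of x] frob_norm_pos[of x] jrank_pos[where 'a='a]
  by (simp add: normalized_det_def) 

lemma normalized_det_le_1:
  fixes x :: "'a::euclidean_jordan_algebra"
  assumes x: "x \<in> sym_cone"
  shows "normalized_det x \<le> 1"
proof -
  let ?r = "jrank TYPE('a)"
  \<comment> \<open>The quadratic mean of the eigenvalues: the bounds (l_i / q)^2 - 1 for the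
    logarithms add up to zero.\<close>
  define q where "q = frob_norm x / sqrt (real ?r)"
  have q: "q > 0"
    using frob_norm_pos[OF x] jrank_pos[where 'a='a] by (simp add: q_def)
  obtain l c where lc: "spectral_decomposition x l c"
    using spectral_decomposition_exists by blast
  have l: "l i > 0" if "i < ?r" for i
    using sym_cone_spectral[OF lc] x that by blast
  have "2 * (ln (l i) - ln q) \<le> (l i)\<^sup>2 / q\<^sup>2 - 1" if "i < ?r" for i
  proof -
    have "2 * (ln (l i) - ln q) = ln ((l i / q)\<^sup>2)"
      using l[OF that] q by (simp add: ln_div ln_realpow)
    also have "\<dots> \<le> (l i / q)\<^sup>2 - 1"
      using l[OF that] q by (intro ln_le_minus_one) simp
    finally show ?thesis
      by (simp add: power_divide)
  qed
  then have "(\<Sum>i<?r. 2 * (ln (l i) - ln q)) \<le> (\<Sum>i<?r. (l i)\<^sup>2 / q\<^sup>2 - 1)"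
    by (intro sum_mono) simp
  also have "\<dots> = (frob_norm x)\<^sup>2 / q\<^sup>2 - real ?r"
    by (simp add: sum_subtractf spectral_frob_norm[OF lc] sum_divide_distrib)
  also have "\<dots> = 0"
    using frob_norm_pos[OF x] by (simp add: q_def power_divide)
  finally have "ln (jdet x) \<le> ln (q ^ ?r)"
    using q by (simp add: jdet_sym_cone(3)[OF lc x] sum_subtractf ln_realpow flip: sum_distrib_left)
  then have "jdet x \<le> q ^ ?r"
    using jdet_pos[OF x] q by simp
  then show ?thesis
    using q by (simp add: normalized_det_def flip: q_def)
qed

section \<open>Attainment of the condition measure\<close>

lemma sym_cone_scaleR:
  assumes "x \<in> sym_cone" "s > 0"
  shows "s *\<^sub>R x \<in> sym_cone"
proof -
  obtain m where "m > 0" "x - m *\<^sub>R junit \<in> square_cone"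
    using assms sym_cone_iff_shift by blast
  then have "s *\<^sub>R (x - m *\<^sub>R junit) \<in> square_cone" "s * m > 0"
    using assms(2) by (auto intro: square_cone_scaleR)
  then show ?thesis
    unfolding sym_cone_iff_shift by (intro exI[of _ "s * m"]) (simp add: scaleR_diff_right)
qed

text \<open>Links the trace length to the norm of the class, to which boundedness and compactness
  refer.\<close>

lemma trace_norm_bound:
  "\<exists>k>0. \<forall>x::'a::euclidean_jordan_algebra. k * (norm x)\<^sup>2 \<le> trace_inner x x"
proof -
  have "continuous_on (sphere 0 1) (\<lambda>x::'a. trace_inner x x)"
    by (intro continuous_intros)
  then have "\<exists>u\<in>sphere (0::'a) 1. \<forall>x\<in>sphere (0::'a) 1. trace_inner u u \<le> trace_inner x x"
    by (rule continuous_attains_inf[OF compact_sphere, rotated]) simp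
  then obtain u :: 'a where u: "u \<in> sphere 0 1" "\<And>x::'a. x \<in> sphere 0 1 \<Longrightarrow> trace_inner u u \<le> trace_inner x x"
    by blast
  have "trace_inner u u * (norm x)\<^sup>2 \<le> trace_inner x x" for x :: 'a
  proof (cases "x = 0")
    case False
    have "trace_inner u u \<le> trace_inner ((1 / norm x) *\<^sub>R x) ((1 / norm x) *\<^sub>R x)"
      using False by (intro u(2)) simp
    then show ?thesis
      using False by (simp add: trace.form_scaleR_left trace.form_scaleR_right field_simps power2_eq_square)
  qed simp
  moreover have "u \<noteq> 0"
    using u(1) by auto
  ultimately show ?thesis
    using trace.form_pos[of u] by blast
qed

lemma compact_cone_slice:
  fixes L :: "'a::euclidean_jordan_algebra set"
  assumes "subspace L"
  shows "compact {x \<in> L. x \<in> square_cone \<and> trace_inner x x = k}"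
proof -
  obtain a where a: "a > 0" "\<And>x::'a. a * (norm x)\<^sup>2 \<le> trace_inner x x"
    using trace_norm_bound by blast
  have "bounded {x \<in> L. x \<in> square_cone \<and> trace_inner x x = k}"
  proof (rule boundedI)
    fix x assume "x \<in> {x \<in> L. x \<in> square_cone \<and> trace_inner x x = k}"
    then have "a * (norm x)\<^sup>2 \<le> k"
      using a(2)[of x] by simp
    then have "(norm x)\<^sup>2 \<le> k / a"
      using a(1) by (simp add: pos_le_divide_eq mult.commute)
    then show "norm x \<le> sqrt (k / a)"
      by (rule real_le_rsqrt)
  qed
  moreover have "closed {x \<in> L. x \<in> square_cone \<and> trace_inner x x = k}"
  proof -
    have "{x \<in> L. x \<in> square_cone \<and> trace_inner x x = k} = L \<inter> square_cone \<inter> {x. trace_inner x x = k}"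
      by blast
    moreover have "closed \<dots>"
      by (intro closed_Int closed_subspace[OF assms] closed_square_cone closed_Collect_eq continuous_intros)
    ultimately show ?thesis by simp
  qed
  ultimately show ?thesis
    by (simp add: compact_eq_bounded_closed)
qed

text \<open>Taking $x = z + \varepsilon e$ in Klein's inequality bounds the determinants of a sequence
  converging to $z$, so no continuity of the determinant is needed.\<close>

lemma jdet_limit_le:
  fixes z :: "'a::euclidean_jordan_algebra"
  assumes y: "\<And>n. y n \<in> sym_cone" "y \<longlonglongrightarrow> z" and z: "z \<in> square_cone"
    and lim: "(\<lambda>n. jdet (y n)) \<longlonglongrightarrow> d" "d > 0"
  shows "z \<in> sym_cone" "d \<le> jdet z"
proof -
  let ?r = "jrank TYPE('a)"
  obtain l c where lc: "spectral_decomposition z l c"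
    using spectral_decomposition_exists by blast
  then have c: "jordan_frame c"
    by (simp add: spectral_decomposition_def)
  have l: "l i \<ge> 0" if "i < ?r" for i
    using square_cone_spectral[OF lc] z that by blast
  have "d \<le> (\<Prod>i<?r. l i + e)" if e: "e > 0" for e
  proof -
    define x where "x = z + e *\<^sub>R junit"
    have x: "spectral_decomposition x (\<lambda>i. l i + e) c"
      using spectral_decomposition_affine[OF lc, of 1 e] by (simp add: x_def)
    have "x \<in> sym_cone"
      using l e by (subst sym_cone_spectral[OF x]) (auto intro: add_nonneg_pos)
    define w where "w = (\<Sum>i<?r. inverse (l i + e) *\<^sub>R c i)"
    have w: "spectral_decomposition w (\<lambda>i. inverse (l i + e)) c"
      using c by (simp add: w_def spectral_decomposition_def)
    have "ln (jdet (y n)) \<le> ln (jdet x) + trace_inner w (y n) - real ?r" for n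
      unfolding w_def by (rule ln_jdet_le[OF x \<open>x \<in> sym_cone\<close> y(1)])
    moreover have "(\<lambda>n. ln (jdet (y n))) \<longlonglongrightarrow> ln d"
      using lim by (intro tendsto_ln) auto
    moreover have "(\<lambda>n. trace_inner w (y n)) \<longlonglongrightarrow> trace_inner w z"
    proof -
      have "continuous_on UNIV (trace_inner w)"
        by (intro continuous_intros)
      then show ?thesis
        using y(2) by (auto simp: continuous_on_eq_continuous_at isCont_tendsto_compose)
    qed
    then have "(\<lambda>n. ln (jdet x) + trace_inner w (y n) - real ?r)
        \<longlonglongrightarrow> ln (jdet x) + trace_inner w z - real ?r"
      by (intro tendsto_intros)
    ultimately have "ln d \<le> ln (jdet x) + trace_inner w z - real ?r"
      by (intro LIMSEQ_le[of "\<lambda>n. ln (jdet (y n))" "ln d"]) auto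
    \<comment> \<open>The summands are l_i / (l_i + e), each at most 1.\<close>
    also have "trace_inner w z \<le> (\<Sum>i<?r. 1)"
      unfolding spectral_trace_inner[OF w lc]
      using l e by (intro sum_mono) (simp add: divide_simps add_nonneg_pos)
    finally have "ln d \<le> ln (jdet x)"
      by simp
    then have "d \<le> jdet x"
      using lim(2) jdet_pos[OF \<open>x \<in> sym_cone\<close>] by simp
    then show ?thesis
      using jdet_sym_cone(1)[OF x \<open>x \<in> sym_cone\<close>] by simp
  qed
  \<comment> \<open>Letting e tend to 0 bounds d by the product of the l_i; as d > 0, no eigenvalue
    vanishes and z is not on the boundary.\<close>
  then have "\<forall>\<^sub>F e in at_right 0. d \<le> (\<Prod>i<?r. l i + e)"
    by (auto simp: eventually_at_filter)
  moreover have "((\<lambda>e. \<Prod>i<?r. l i + e) \<longlongrightarrow> (\<Prod>i<?r. l i + 0)) (at_right 0)"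
    by (intro tendsto_intros)
  ultimately have d: "d \<le> (\<Prod>i<?r. l i)"
    by (intro tendsto_lowerbound[of "\<lambda>e. \<Prod>i<?r. l i + e" _ "at_right 0"]) auto
  then have "l i \<noteq> 0" if "i < ?r" for i
    using lim(2) that by (metis lessThan_iff finite_lessThan not_less prod_zero)
  then show "z \<in> sym_cone"
    using l by (subst sym_cone_spectral[OF lc]) (auto simp: less_le)
  then show "d \<le> jdet z"
    using d jdet_sym_cone(1)[OF lc] by simp
qed

text \<open>\<open>GREATEST\<close> is meaningful only if the maximum exists, and the slice of the
  open cone need not be compact. A maximising sequence converges in the closed slice, and a positive
  supremum keeps its limit off the boundary.\<close>

lemma cond_measure_attained:
  fixes L :: "'a::euclidean_jordan_algebra set"
  assumes L: "subspace L" "L \<inter> sym_cone \<noteq> {}"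
  obtains x where "x \<in> L \<inter> sym_cone" "cond_measure L = normalized_det x"
proof -
  let ?r = "jrank TYPE('a)"
  define S where "S = {x \<in> L \<inter> sym_cone. trace_inner x x = real ?r}"
  have nd: "normalized_det x = jdet x" if "x \<in> S" for x
    using that jrank_pos[where 'a='a] by (simp add: S_def normalized_det_def frob_norm_def)
  obtain x0 where x0: "x0 \<in> L" "x0 \<in> sym_cone"
    using L(2) by blast
  have "trace_inner x0 x0 > 0"
    using x0 zero_notin_sym_cone by (metis trace.form_pos)
  then have "sqrt (real ?r / trace_inner x0 x0) *\<^sub>R x0 \<in> S"
    using x0 L(1) jrank_pos[where 'a='a]
    by (auto simp: S_def subspace_scale sym_cone_scaleR trace.form_scaleR_left trace.form_scaleR_right
        simp flip: mult.assoc)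
  then have "S \<noteq> {}"
    by blast
  have bdd: "bdd_above (jdet ` S)"
    using nd normalized_det_le_1 by (intro bdd_aboveI[of _ 1]) (force simp: S_def)
  define d where "d = Sup (jdet ` S)"
  have le_d: "jdet x \<le> d" if "x \<in> S" for x
    unfolding d_def using that bdd by (intro cSup_upper) auto
  have "d > 0"
    using \<open>S \<noteq> {}\<close> le_d jdet_pos by (force simp: S_def)
  have "\<exists>x\<in>S. d - 1 / real (Suc n) < jdet x" for n
  proof -
    have "d - 1 / real (Suc n) < Sup (jdet ` S)"
      by (simp add: d_def)
    then show ?thesis
      using \<open>S \<noteq> {}\<close> bdd by (subst (asm) less_cSup_iff) auto
  qed
  then obtain y where y: "\<And>n. y n \<in> S" "\<And>n. d - 1 / real (Suc n) < jdet (y n)"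
    by metis
  have lim: "(\<lambda>n. jdet (y n)) \<longlonglongrightarrow> d"
  proof (rule tendsto_sandwich)
    show "(\<lambda>n. d - 1 / real (Suc n)) \<longlonglongrightarrow> d"
      using tendsto_diff[OF tendsto_const LIMSEQ_inverse_real_of_nat, of d] by (simp add: inverse_eq_divide)
    show "\<forall>\<^sub>F n in sequentially. d - 1 / real (Suc n) \<le> jdet (y n)"
      using y(2) by (intro always_eventually) (auto intro: less_imp_le)
    show "\<forall>\<^sub>F n in sequentially. jdet (y n) \<le> d"
      using y(1) le_d by (intro always_eventually) auto
  qed (rule tendsto_const)
  have "seq_compact {x \<in> L. x \<in> square_cone \<and> trace_inner x x = real ?r}"
    using compact_cone_slice[OF L(1)] by (rule compact_imp_seq_compact)
  moreover have "\<forall>n. y n \<in> {x \<in> L. x \<in> square_cone \<and> trace_inner x x = real ?r}"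
    using y(1) sym_cone_subset by (auto simp: S_def)
  ultimately obtain z f where z: "z \<in> L" "z \<in> square_cone" "trace_inner z z = real ?r"
    and f: "strict_mono f" "(y \<circ> f) \<longlonglongrightarrow> z"
    using seq_compactE by (metis (mono_tags, lifting) mem_Collect_eq)
  have ysym: "(y \<circ> f) n \<in> sym_cone" for n
    using y(1) by (auto simp: S_def)
  have "(\<lambda>n. jdet ((y \<circ> f) n)) \<longlonglongrightarrow> d"
    using LIMSEQ_subseq_LIMSEQ[OF lim f(1)] by (simp add: comp_def)
  note zlim = jdet_limit_le[OF ysym f(2) z(2) this \<open>d > 0\<close>]
  have "z \<in> S"
    using z zlim(1) by (simp add: S_def)
  have "cond_measure L = jdet z"
    unfolding cond_measure_def
  proof (rule Greatest_equality)
    show "\<exists>x\<in>L \<inter> sym_cone. (frob_norm x)\<^sup>2 = real ?r \<and> jdet z = jdet x"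
      using \<open>z \<in> S\<close> by (auto simp: S_def frob_norm_square)
    fix a assume "\<exists>x\<in>L \<inter> sym_cone. (frob_norm x)\<^sup>2 = real ?r \<and> a = jdet x"
    then have "a \<le> d"
      using le_d by (auto simp: S_def frob_norm_square)
    then show "a \<le> jdet z"
      using zlim(2) by simp
  qed
  then show thesis
    using that[of z] nd[OF \<open>z \<in> S\<close>] z(1) zlim(1) by simp
qed

section \<open>The effect of one rescaling step\<close>

lemma square_le_frob_norm:
  fixes y :: "'a::euclidean_jordan_algebra"
  assumes "y \<in> square_cone"
  shows "frob_norm y *\<^sub>R y - y \<circ>\<^sub>J y \<in> square_cone"
proof -
  let ?r = "jrank TYPE('a)"
  obtain l c where lc: "spectral_decomposition y l c"
    using spectral_decomposition_exists by blast
  then have c: "jordan_frame c" "y = (\<Sum>i<?r. l i *\<^sub>R c i)"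
    by (auto simp: spectral_decomposition_def)
  have l: "l i \<ge> 0" if "i < ?r" for i
    using square_cone_spectral[OF lc] assms that by blast
  have le: "l i \<le> frob_norm y" if "i < ?r" for i
  proof -
    have "(l i)\<^sup>2 \<le> (frob_norm y)\<^sup>2"
      unfolding spectral_frob_norm[OF lc] using that by (intro member_le_sum) auto
    then show ?thesis
      using frob_norm_nonneg by (rule power2_le_imp_le)
  qed
  have "frob_norm y *\<^sub>R y = (\<Sum>i<?r. (frob_norm y * l i) *\<^sub>R c i)"
    by (subst (2) c(2)) (simp add: scaleR_sum_right)
  then have "spectral_decomposition (frob_norm y *\<^sub>R y - y \<circ>\<^sub>J y) (\<lambda>i. frob_norm y * l i - l i * l i) c"
    using c(1) by (simp add: spectral_decomposition_def spectral_jprod[OF lc lc] scaleR_diff_left sum_subtractf)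
  moreover have "0 \<le> frob_norm y * l i - l i * l i" if "i < ?r" for i
    using mult_right_mono[OF le[OF that] l[OF that]] by simp
  ultimately show ?thesis
    using square_cone_spectral by blast
qed

lemma eigmax_square_cone:
  fixes z :: "'a::euclidean_jordan_algebra"
  assumes "z \<in> square_cone" "z \<noteq> 0"
  shows "eigmax z > 0" "spec_norm z = eigmax z"
proof -
  obtain d where d: "spectral_decomposition z (eigval z) d"
    using spectral_decomposition_eigval by blast
  have ev: "eigval z i \<ge> 0" if "i < jrank TYPE('a)" for i
    using square_cone_spectral[OF d] assms(1) that by blast
  have "\<exists>i<jrank TYPE('a). eigval z i \<noteq> 0"
  proof (rule ccontr)
    assume "\<not> (\<exists>i<jrank TYPE('a). eigval z i \<noteq> 0)"
    then have "(\<Sum>i<jrank TYPE('a). eigval z i *\<^sub>R d i) = 0"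
      by simp
    then show False
      using d assms(2) by (simp add: spectral_decomposition_def)
  qed
  then obtain i where "i < jrank TYPE('a)" "eigval z i > 0"
    using ev by (auto simp: less_le)
  then show "eigmax z > 0"
    unfolding eigmax_def by (subst Max_gr_iff) auto
  show "spec_norm z = eigmax z"
    unfolding spec_norm_def eigmax_def using ev by (intro arg_cong[of _ _ Max] image_cong) auto
qed

text \<open>The difference w satisfies wc = 0, so its eigenvectors with non-zero eigenvalue are
  orthogonal to c. On them w and z pair alike, and z is in the cone.\<close>

lemma peirce_component_square_cone:
  fixes z :: "'a::euclidean_jordan_algebra"
  assumes z: "z \<in> square_cone" and c: "primitive_idempotent c" "z \<circ>\<^sub>J c = k *\<^sub>R c"
  shows "z - k *\<^sub>R c \<in> square_cone"
proof -
  define w where "w = z - k *\<^sub>R c"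
  have wc: "w \<circ>\<^sub>J c = 0"
    by (simp add: w_def jprod_simps c primitive_idempotentD(3)[OF c(1)])
  obtain l d where ld: "spectral_decomposition w l d"
    using spectral_decomposition_exists by blast
  have "l i \<ge> 0" if i: "i < jrank TYPE('a)" for i
  proof (cases "l i = 0")
    case False
    have d: "primitive_idempotent (d i)"
      using ld i by (simp add: spectral_decomposition_def jordan_frame_def)
    have "l i * trace_inner (d i) c = trace_inner (w \<circ>\<^sub>J d i) c"
      by (simp add: spectral_jprod_frame[OF ld i] trace.form_scaleR_left)
    also have "\<dots> = 0"
      by (simp add: trace.form_move wc)
    finally have "trace_inner c (d i) = 0"
      using False by (simp add: trace.form_commute[of c])
    then have "l i = trace_inner z (d i)"
      using spectral_trace_frame[OF ld i] by (simp add: w_def trace.form_simps)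
    then show ?thesis
      using z d square_cone_iff by auto
  qed simp
  then show ?thesis
    unfolding w_def[symmetric] square_cone_spectral[OF ld] by blast
qed

lemma rescaling_improves:
  fixes M :: "'a::euclidean_jordan_algebra set"
  assumes M: "subspace M" and y: "y \<in> M" "y \<in> sym_cone"
    and z: "basic_output (subspace_proj M) z" "subspace_proj M z \<notin> sym_cone"
    and c: "primitive_idempotent c" "z \<circ>\<^sub>J c = eigmax z *\<^sub>R c"
  shows "1.5 * normalized_det y \<le> normalized_det (scale_map c (sqrt 2) y)"
proof -
  define r where "r = jrank TYPE('a)"
  have r: "r > 0"
    using jrank_pos[where 'a='a] by (simp add: r_def)
  define N where "N = frob_norm y"
  define k where "k = eigmax z"
  define s where "s = trace_inner c y"
  have N: "N > 0"
    using frob_norm_pos[OF y(2)] by (simp add: N_def)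
  have yK: "y \<in> square_cone"
    using y(2) sym_cone_subset by blast
  have zK: "z \<in> square_cone" "z \<noteq> 0"
    using z(1) by (auto simp: basic_output_def closure_sym_cone)
  note k = eigmax_square_cone[OF zK, folded k_def]
  have s0: "s \<ge> 0"
    unfolding s_def by (rule trace_inner_primitive_nonneg[OF c(1) y(2)])
  have "trace_inner (z - k *\<^sub>R c) y \<ge> 0"
    using peirce_component_square_cone[OF zK(1) c] yK
    by (intro square_cone_inner_nonneg) (simp_all add: k_def)
  then have "k * s \<le> trace_inner z y"
    by (simp add: trace.form_simps s_def)
  also have "\<dots> = trace_inner (subspace_proj M z) y"
    using subspace_proj(2)[OF M y(1), of z] by (simp add: trace.form_diff_left)
  also have "\<dots> \<le> trace_inner (cone_proj (subspace_proj M z)) y"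
    by (rule cone_proj[OF yK])
  also have "\<dots> \<le> frob_norm (cone_proj (subspace_proj M z)) * N"
    using trace_inner_le_frob_norm abs_le_D1 unfolding N_def by blast
  also have "\<dots> \<le> (1 / (4 * real r) * k) * N"
    using z N k(2) by (intro mult_right_mono) (simp_all add: basic_output_def r_def)
  finally have s: "s \<le> N / (4 * real r)"
    using k(1) r by (simp add: field_simps)
  define S where "S = scale_map c (sqrt 2) y"
  have S: "S \<in> sym_cone" "jdet S = 2 * jdet y"
    using c(1) y(2) by (simp_all add: S_def scale_map_sym_cone_iff jdet_scale_map)
  \<comment> \<open>Controls the cross term of the new norm: an eigenvalue of y in the cone is at
    most the Frobenius norm, hence <y^2, c> <= N s.\<close>
  have "trace_inner (frob_norm y *\<^sub>R y - y \<circ>\<^sub>J y) c \<ge> 0"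
    using square_le_frob_norm[OF yK] c(1) square_cone_iff by blast
  then have "trace_inner y (c \<circ>\<^sub>J y) \<le> N * s"
    by (simp add: trace.form_simps N_def s_def trace.form_commute[of y c] trace.form_assoc
        jprod_commute[of y c])
  \<comment> \<open>Self-adjointness and sqrt 2 * sqrt 2 = 2 reduce the square to a single map with
    parameter 2, whose coefficients are 2 and 1.\<close>
  moreover have "trace_inner S S = N\<^sup>2 + 2 * trace_inner y (c \<circ>\<^sub>J y) + s\<^sup>2"
  proof -
    have "trace_inner S S = trace_inner y (scale_map c 2 y)"
      by (simp add: S_def trace_inner_scale_map scale_map_mult[OF c(1)])
    then show ?thesis
      unfolding N_def frob_norm_square
      by (simp add: scale_map_def trace.form_simps s_def trace.form_commute[of y c] power2_eq_square)
  qed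
  ultimately have "(frob_norm S)\<^sup>2 \<le> N\<^sup>2 + 2 * (N * s) + s\<^sup>2"
    by (simp add: frob_norm_square)
  also have "\<dots> = (N + s)\<^sup>2"
    by (simp add: power2_eq_square algebra_simps)
  also have "\<dots> \<le> (N * (1 + 1 / (4 * real r)))\<^sup>2"
    using N s s0 by (intro power_mono) (simp_all add: algebra_simps)
  finally have FS: "frob_norm S \<le> N * (1 + 1 / (4 * real r))"
    using N by (intro power2_le_imp_le[of "frob_norm S"]) auto
  have "(1 + 1 / (4 * real r)) ^ r \<le> exp (1 / (4 * real r)) ^ r"
    by (intro power_mono exp_ge_add_one_self) auto
  also have "\<dots> = exp (1 / 4)"
    using r by (simp flip: exp_of_nat_mult)
  \<comment> \<open>From e^(-1/4) >= 1 - 1/4. Doubling the determinant while the normalising power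
    grows by at most 4/3 gives the factor 1.5.\<close>
  also have "\<dots> \<le> 4 / 3"
  proof -
    have "3 / 4 \<le> exp (- (1 / 4) :: real)"
      using exp_ge_add_one_self[of "- (1 / 4) :: real"] by simp
    then show ?thesis
      by (simp add: exp_minus field_simps)
  qed
  finally have "(1 + 1 / (4 * real r)) ^ r \<le> 4 / 3" .
  moreover have "(frob_norm S / sqrt (real r)) ^ r \<le> (N * (1 + 1 / (4 * real r)) / sqrt (real r)) ^ r"
    using FS frob_norm_nonneg[of S] by (intro power_mono divide_right_mono divide_nonneg_nonneg) auto
  moreover have "(N * (1 + 1 / (4 * real r)) / sqrt (real r)) ^ r
      = (N / sqrt (real r)) ^ r * (1 + 1 / (4 * real r)) ^ r"
    by (simp flip: power_mult_distrib)
  ultimately have FSr: "(frob_norm S / sqrt (real r)) ^ r \<le> (N / sqrt (real r)) ^ r * (4 / 3)"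
    using N by (smt (verit) mult_left_mono zero_le_power divide_nonneg_nonneg real_sqrt_ge_zero of_nat_0_le_iff)
  have "1.5 * normalized_det y = jdet S / ((N / sqrt (real r)) ^ r * (4 / 3))"
    by (simp add: normalized_det_def S N_def flip: r_def)
  also have "\<dots> \<le> jdet S / (frob_norm S / sqrt (real r)) ^ r"
    using FSr jdet_pos[OF S(1)] frob_norm_pos[OF S(1)] r N by (intro divide_left_mono mult_pos_pos) auto
  finally show ?thesis
    by (simp add: normalized_det_def S_def flip: r_def)
qed

section \<open>Invariants of runs and termination\<close>

definition map_invariant ::
  "'a::euclidean_jordan_algebra set \<Rightarrow> 'a \<Rightarrow> nat \<Rightarrow> ('a \<Rightarrow> 'a) \<Rightarrow> ('a \<Rightarrow> 'a) \<Rightarrow> bool" where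
  "map_invariant L x0 n D P \<longleftrightarrow> linear D \<and> bij D \<and> (\<forall>x. D x \<in> sym_cone \<longleftrightarrow> x \<in> sym_cone) \<and>
     P = subspace_proj (D ` L) \<and> 1.5 ^ n * normalized_det x0 \<le> normalized_det (D x0)"

text \<open>The equivalence in \<open>map_invariant\<close> moves x0 forward under D and the
  returned point back under its inverse. A halted configuration has lost D, so there the growth of
  the normalised determinant is kept as a comparison with 1.\<close>

primrec run_invariant :: "'a::euclidean_jordan_algebra set \<Rightarrow> 'a \<Rightarrow> 'a config \<Rightarrow> bool" where
  "run_invariant L x0 (Basic n D P) \<longleftrightarrow> map_invariant L x0 n D P"
| "run_invariant L x0 (Rescale n D P z) \<longleftrightarrow> map_invariant L x0 n D P \<and>
     basic_output P z \<and> P z \<notin> sym_cone"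
| "run_invariant L x0 (Halted n x) \<longleftrightarrow> x \<in> L \<inter> sym_cone \<and> 1.5 ^ n * normalized_det x0 \<le> 1"

lemma run_invariant_init:
  assumes "subspace L"
  shows "run_invariant L x0 (alg_init L)"
  by (simp add: alg_init_def map_invariant_def linear_id)

lemma run_invariant_step:
  fixes L :: "'a::euclidean_jordan_algebra set"
  assumes "alg_step L s s'" and L: "subspace L" and x0: "x0 \<in> L" "x0 \<in> sym_cone"
    and inv: "run_invariant L x0 s"
  shows "run_invariant L x0 s'"
  using assms(1)
proof cases
  case (halt P z n D)
  have D: "linear D" "bij D" "\<And>x. D x \<in> sym_cone \<longleftrightarrow> x \<in> sym_cone" "P = subspace_proj (D ` L)"
    "1.5 ^ n * normalized_det x0 \<le> normalized_det (D x0)"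
    using inv halt by (auto simp: map_invariant_def)
  have "P z \<in> D ` L"
    unfolding D(4) by (intro subspace_proj(1) linear_subspace_image D(1) L)
  then obtain x where x: "x \<in> L" "P z = D x"
    by blast
  have "inv D (P z) = x"
    using x D(2) by (simp add: bij_is_inj)
  moreover have "normalized_det (D x0) \<le> 1"
    using normalized_det_le_1 D(3) x0 by blast
  ultimately show ?thesis
    using halt x D(3,5) by simp
next
  case (continue P z n D)
  then show ?thesis
    using inv by simp
next
  case (rescale c z v D' D n P)
  have D: "linear D" "bij D" "\<And>x. D x \<in> sym_cone \<longleftrightarrow> x \<in> sym_cone" "P = subspace_proj (D ` L)"
    "1.5 ^ n * normalized_det x0 \<le> normalized_det (D x0)"
    and z: "basic_output P z" "P z \<notin> sym_cone"
    using inv rescale by (auto simp: map_invariant_def)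
  have v: "quad_map v = scale_map c (sqrt 2)"
    using quad_map_scale_map[OF rescale(3), of "sqrt 2 - 1"] rescale(5) by simp
  have "1.5 * normalized_det (D x0) \<le> normalized_det (scale_map c (sqrt 2) (D x0))"
    using x0 D(3) z rescale(3,4) unfolding D(4)
    by (intro rescaling_improves[of "D ` L" _ z] linear_subspace_image D(1) L) auto
  then have "1.5 ^ Suc n * normalized_det x0 \<le> normalized_det (D' x0)"
    using D(5) rescale(6) v by simp
  moreover have "linear D'" "bij D'"
    using rescale(6) v D(1,2) linear_compose[OF D(1) linear_scale_map]
      bij_comp[OF D(2) bij_scale_map[OF rescale(3)]] by (simp_all add: comp_def)
  moreover have "D' x \<in> sym_cone \<longleftrightarrow> x \<in> sym_cone" for x
    using rescale(6) v D(3) scale_map_sym_cone_iff[OF rescale(3)] by simp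
  ultimately show ?thesis
    using rescale(2) by (simp add: map_invariant_def)
qed

text \<open>Neither other kind of configuration can be stuck: D x0 is fixed by the projection and
  meets the specification of the basic procedure, and a member of a frame of z at the largest
  eigenvalue is a legal c.\<close>

lemma alg_step_progress:
  fixes L :: "'a::euclidean_jordan_algebra set"
  assumes L: "subspace L" and x0: "x0 \<in> L" "x0 \<in> sym_cone" and inv: "run_invariant L x0 s"
    and stuck: "\<nexists>s'. alg_step L s s'"
  obtains n x where "s = Halted n x"
proof (cases s)
  case (Basic n D P)
  then have D: "linear D" "D x0 \<in> sym_cone" "P = subspace_proj (D ` L)"
    using inv x0 by (auto simp: map_invariant_def)
  have "P (D x0) = D x0"
    unfolding D(3) using x0 by (intro subspace_proj_ident linear_subspace_image D(1) L) auto
  moreover have "D x0 \<in> closure sym_cone - {0}"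
    using D(2) zero_notin_sym_cone closure_subset by fastforce
  ultimately have "basic_output P (D x0)" "P (D x0) \<in> sym_cone"
    using D(2) by (simp_all add: basic_output_def)
  then show ?thesis
    using stuck alg_step.halt Basic by blast
next
  case (Rescale n D P z)
  obtain d where d: "spectral_decomposition z (eigval z) d"
    using spectral_decomposition_eigval by blast
  have "eigmax z \<in> eigval z ` {..<jrank TYPE('a)}"
    unfolding eigmax_def using jrank_pos[where 'a='a] by (intro Max_in) auto
  then obtain i where "i < jrank TYPE('a)" "eigmax z = eigval z i"
    by auto
  then have "primitive_idempotent (d i)" "z \<circ>\<^sub>J d i = eigmax z *\<^sub>R d i"
    using d spectral_jprod_frame[OF d] by (auto simp: spectral_decomposition_def jordan_frame_def)
  then show ?thesis
    using stuck alg_step.rescale Rescale by blast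
qed

text \<open>The number of transitions since the start: two per main iteration, and one more once the
  basic procedure has returned, whether a rescaling follows or the run halts.\<close>

primrec calls :: "'a config \<Rightarrow> nat" where
  "calls (Basic n D P) = 2 * n"
| "calls (Rescale n D P z) = 2 * n + 1"
| "calls (Halted n x) = 2 * n + 1"

lemma alg_step_calls:
  assumes "alg_step L s s'" "alg_step L s' s''"
  shows "calls s' = Suc (calls s)"
  using assms(1)
proof cases
  case halt
  then show ?thesis
    using assms(2) by (auto elim: alg_step.cases)
qed simp_all

theorem theorem3:
  fixes L :: "'a::euclidean_jordan_algebra set"
  assumes "subspace L"
    and "L \<inter> sym_cone \<noteq> {}"
  shows "(\<nexists>s :: nat \<Rightarrow> 'a config. s 0 = alg_init L \<and> (\<forall>k. alg_step L (s k) (s (Suc k)))) \<and>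
    (\<forall>s. (alg_step L)\<^sup>*\<^sup>* (alg_init L) s \<and> (\<nexists>s'. alg_step L s s') \<longrightarrow>
      (\<exists>n x. s = Halted n x \<and> x \<in> L \<inter> sym_cone \<and>
        real n \<le> log 1.5 (1 / cond_measure L)))"
proof (intro conjI notI allI impI)
  obtain x0 where x0: "x0 \<in> L" "x0 \<in> sym_cone" "cond_measure L = normalized_det x0"
    using cond_measure_attained[OF assms] by blast
  note pos = normalized_det_pos[OF x0(2)]
  note step = run_invariant_step[OF _ assms(1) x0(1,2)]
  {
    assume "\<exists>s :: nat \<Rightarrow> 'a config. s 0 = alg_init L \<and> (\<forall>k. alg_step L (s k) (s (Suc k)))"
    then obtain s :: "nat \<Rightarrow> 'a config"
      where s: "s 0 = alg_init L" "\<And>k. alg_step L (s k) (s (Suc k))"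
      by blast
    have inv: "run_invariant L x0 (s k)" for k
      by (induction k) (use s run_invariant_init[OF assms(1)] step in auto)
    have calls: "calls (s k) = k" for k
      by (induction k) (use s alg_step_calls[OF s(2) s(2)] in \<open>auto simp: alg_init_def\<close>)
    obtain n where "1 / normalized_det x0 < 1.5 ^ n"
      using real_arch_pow[of "1.5" "1 / normalized_det x0"] by auto
    then have n: "1 < 1.5 ^ n * normalized_det x0"
      using pos by (simp add: field_simps)
    \<comment> \<open>Parity: after 2n transitions only a \<open>Basic\<close> configuration is
      possible, and its invariant contradicts the choice of n.\<close>
    have odd: "Suc (2 * m) \<noteq> 2 * n" for m
      by presburger
    then obtain D P where "s (2 * n) = Basic n D P"
      using calls[of "2 * n"] by (cases "s (2 * n)") (auto simp: odd)
    then have "D x0 \<in> sym_cone" "1.5 ^ n * normalized_det x0 \<le> normalized_det (D x0)"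
      using inv[of "2 * n"] x0(2) by (auto simp: map_invariant_def)
    then show False
      using n normalized_det_le_1[of "D x0"] by linarith
  }
  fix s
  assume s: "(alg_step L)\<^sup>*\<^sup>* (alg_init L) s \<and> (\<nexists>s'. alg_step L s s')"
  then have "(alg_step L)\<^sup>*\<^sup>* (alg_init L) s" ..
  then have inv: "run_invariant L x0 s"
    by (induction rule: rtranclp_induct) (auto intro: run_invariant_init[OF assms(1)] step)
  obtain n x where nx: "s = Halted n x"
    using alg_step_progress[OF assms(1) x0(1,2) inv] s by blast
  then have "x \<in> L \<inter> sym_cone" "1.5 ^ n * normalized_det x0 \<le> 1"
    using inv by auto
  moreover have "real n \<le> log 1.5 (1 / cond_measure L)"
  proof -
    have "1.5 ^ n \<le> 1 / normalized_det x0"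
      using pos \<open>1.5 ^ n * normalized_det x0 \<le> 1\<close> by (simp add: field_simps)
    then have "1.5 powr real n \<le> 1 / cond_measure L"
      by (simp add: powr_realpow x0(3))
    then show ?thesis
      using pos x0(3) by (subst le_log_iff) auto
  qed
  ultimately show "\<exists>n x. s = Halted n x \<and> x \<in> L \<inter> sym_cone \<and> real n \<le> log 1.5 (1 / cond_measure L)"
    using nx by blast
qed

end
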